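(* There is an absolute constant $c'>0$ such that for each positive integer $n$ there is a $K_4$-free graph on $n$ vertices with at least $\frac{n^2}{8}$ edges and independence number at most $c'\, n \cdot \frac{(\log\log n)^{3/2}}{(\log n)^{1/2}}$.
   Context: Logarithms are natural.
   Formalization: The claim is stated for n at least 3 rather than for each positive integer n: for n = 1 a graph has 0 < 1/8 edges and log log n is undefined, and for n = 2 log log n is negative, so its 3/2 power is not real. *)

theory Defs
  imports "HOL-Analysis.Analysis" "HOL-Library.Ramsey"
begin

definition simple_graph :: "'a set \<Rightarrow> 'a set set \<Rightarrow> bool" where
  "simple_graph V E \<longleftrightarrow> finite V \<and> E \<subseteq> [V]\<^bsup>2\<^esup>"

definition complete_free :: "nat \<Rightarrow> 'a set \<Rightarrow> 'a set set \<Rightarrow> bool" where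
  "complete_free k V E \<longleftrightarrow> \<not> (\<exists>K \<in> [V]\<^bsup>k\<^esup>. clique K E)"

definition independence_number :: "'a set \<Rightarrow> 'a set set \<Rightarrow> nat" where
  "independence_number V E = Max (card ` {S. S \<subseteq> V \<and> indep S E})"

end

theory Submission
  imports Defs "HOL-Real_Asymp.Real_Asymp"
begin

text \<open>
  The graph is a discrete variant of the Bollobas--Erdos graph in which the sphere is replaced by
  a product of \<open>h\<close> intervals. Each coordinate of a point of \<open>{0..<4r}\<^sup>h\<close> is sent into \<open>[-1,1]\<close>
  by a truncated linear map. Two copies \<open>X\<close> and \<open>Y\<close> of these points are taken; inside a copy, two
  points are joined when they are nearly antipodal, meaning \<open>|x + x'|\<^sup>2 \<le> s\<close>, and across the copies
  \<open>x\<close> and \<open>y\<close> are joined when \<open>\<langle>x, y\<rangle> > s/4\<close>. Since \<open>\<langle>x + x', y + y'\<rangle> \<le> s\<close> there is no \<open>K\<^sub>4\<close> with two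
  vertices on each side, and there are no triangles inside a copy once points of small norm lose
  their inner edges.

  Gaussian concentration in the Euclidean metric, obtained from a tensorizing transport inequality on
  the discrete interval, shows that a set without nearly antipodal pairs has density \<open>exp(-\<Omega>(s))\<close>.
  Because a positive proportion of the products of coordinates are random signs, \<open>\<langle>x, y\<rangle>\<close> falls in \<open>[-s/4, s/4]\<close> with
  probability \<open>O(s/\<surd>h)\<close> only, so the cross density is \<open>1/2 - O(s/\<surd>h)\<close>. With \<open>s\<close> of order \<open>log h\<close> and
  \<open>h\<close> of order \<open>log n / log log n\<close> the loss is \<open>O((log log n)\<^bsup>3/2\<^esup> / (log n)\<^bsup>1/2\<^esup>)\<close>. It is compensated by an
  independent set of that relative size joined to all of \<open>X\<close>, which creates no \<open>K\<^sub>4\<close> because \<open>X\<close>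
  is triangle-free.
\<close>

section \<open>A transport inequality on the discrete interval\<close>

text \<open>The transport curves below are piecewise linear, so derivatives are missing at finitely
  many breakpoints. Splitting the interval at an exceptional point inside it removes that point from
  the count.\<close>

lemma nondecreasing_finite_exceptions:
  fixes f :: "real \<Rightarrow> real"
  assumes "finite B" and "a \<le> b" and "continuous_on {a..b} f"
    and "\<And>t. a < t \<Longrightarrow> t < b \<Longrightarrow> t \<notin> B \<Longrightarrow> \<exists>D\<ge>0. (f has_real_derivative D) (at t)"
  shows "f a \<le> f b"
  using assms
proof (induction B arbitrary: a b rule: finite_induct)
  case empty
  show ?case
  proof (cases "a = b")
    case False
    then have "a < b" using empty by simp
    then show ?thesis
      by (rule DERIV_nonneg_imp_increasing_open[OF less_imp_le]) (use empty in auto)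
  qed simp
next
  case (insert p B)
  show ?case
  proof (cases "a < p \<and> p < b")
    case True
    have "f a \<le> f p"
      by (rule insert.IH) (use True insert.prems in \<open>auto intro: continuous_on_subset\<close>)
    also have "f p \<le> f b"
      by (rule insert.IH) (use True insert.prems in \<open>auto intro: continuous_on_subset\<close>)
    finally show ?thesis .
  next
    case False
    show ?thesis
      by (rule insert.IH) (use False insert.prems in auto)
  qed
qed

section \<open>Quantile functions of step densities\<close>

definition ramp :: "real \<Rightarrow> real \<Rightarrow> real \<Rightarrow> real" where
  "ramp a p t = max 0 (min 1 ((t - a) / p))"

lemma ramp_derivative:
  assumes "0 < p" "t \<noteq> a" "t \<noteq> a + p"
  shows "(ramp a p has_real_derivative (if a < t \<and> t < a + p then 1 / p else 0)) (at t)"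
proof -
  consider "t < a" | "a + p < t" | "a < t" "t < a + p" using assms by linarith
  then show ?thesis
  proof cases
    case 1
    have "((\<lambda>t. 0) has_real_derivative 0) (at t)" by simp
    then have "(ramp a p has_real_derivative 0) (at t)"
      by (rule has_field_derivative_transform_within_open[where S = "{..<a}"])
        (use 1 assms in \<open>auto simp: ramp_def divide_simps min_def max_def\<close>)
    then show ?thesis using 1 by simp
  next
    case 2
    have "((\<lambda>t. 1) has_real_derivative 0) (at t)" by simp
    then have "(ramp a p has_real_derivative 0) (at t)"
      by (rule has_field_derivative_transform_within_open[where S = "{a+p<..}"])
        (use 2 assms in \<open>auto simp: ramp_def divide_simps min_def max_def\<close>)
    then show ?thesis using 2 by simp
  next
    case 3
    have "((\<lambda>t. (t - a) / p) has_real_derivative 1 / p) (at t)"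
      by (rule derivative_eq_intros refl | use assms in simp)+
    then have "(ramp a p has_real_derivative 1 / p) (at t)"
      by (rule has_field_derivative_transform_within_open[where S = "{a<..<a+p}"])
        (use 3 assms in \<open>auto simp: ramp_def divide_simps min_def max_def\<close>)
    then show ?thesis using 3 by simp
  qed
qed

text \<open>\<open>X\<close> is the inverse distribution function of the density equal to
  \<open>p i\<close> on \<open>[i, i + 1]\<close>: it crosses that cell while \<open>t\<close> runs
  over an interval of length \<open>p i\<close>, hence the slope \<open>1 / p i\<close>.\<close>

lemma step_density_quantile:
  fixes p :: "nat \<Rightarrow> real"
  assumes pos: "\<And>i. i < m \<Longrightarrow> 0 < p i" and one: "(\<Sum>i<m. p i) = 1"
  obtains X B where "finite B" "continuous_on {0..1} X" "X 0 = 0" "X 1 = real m"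
    "\<And>t. 0 < t \<Longrightarrow> t < 1 \<Longrightarrow> t \<notin> B \<Longrightarrow>
      \<exists>i<m. real i \<le> X t \<and> X t \<le> real i + 1 \<and> (X has_real_derivative 1 / p i) (at t)"
proof -
  define a where "a i = (\<Sum>k<i. p k)" for i
  define X where "X t = (\<Sum>i<m. ramp (a i) (p i) t)" for t
  define B where "B = a ` {..m}"
  have a_Suc: "a (Suc i) = a i + p i" for i by (simp add: a_def)
  have a_mono: "a i \<le> a j" if "i \<le> j" "j \<le> m" for i j
    unfolding a_def using that pos by (intro sum_mono2) (auto intro: less_imp_le)
  have a0: "0 \<le> a i" if "i \<le> m" for i using a_mono[of 0 i] that by (simp add: a_def)
  have am: "a m = 1" using one by (simp add: a_def)
  have cont: "continuous_on {0..1} X"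
    unfolding X_def ramp_def by (intro continuous_intros) (use pos in force)
  have X0: "X 0 = 0"
    unfolding X_def
  proof (intro sum.neutral ballI)
    fix i assume "i \<in> {..<m}"
    then have "- a i / p i \<le> 0" using pos[of i] a0[of i] by (simp add: divide_nonpos_pos)
    then show "ramp (a i) (p i) 0 = 0" by (simp add: ramp_def)
  qed
  have X1: "X 1 = real m"
  proof -
    have "ramp (a i) (p i) 1 = 1" if "i < m" for i
    proof -
      have "a i + p i \<le> 1" using a_mono[of "Suc i" m] that am by (simp add: a_Suc)
      then show ?thesis using pos[OF that] by (simp add: ramp_def)
    qed
    then show ?thesis by (simp add: X_def)
  qed
  have main: "\<exists>i<m. real i \<le> X t \<and> X t \<le> real i + 1 \<and> (X has_real_derivative 1 / p i) (at t)"
    if t: "0 < t" "t < 1" "t \<notin> B" for t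
  proof -
    \<comment> \<open>This is the cell reached at time \<open>t\<close>. As \<open>t\<close> avoids
      the breakpoints, it lies strictly inside the interval of that cell; earlier ramps are already
      at 1 and later ones still at 0, so only ramp \<open>i\<close> moves.\<close>
    define i where "i = (GREATEST i. i \<le> m \<and> a i \<le> t)"
    have i: "i \<le> m \<and> a i \<le> t"
      unfolding i_def by (rule GreatestI_nat[where k = 0 and b = m]) (use t in \<open>auto simp: a_def\<close>)
    then have im: "i < m" using am t by (metis le_neq_implies_less not_le)
    have "\<not> a (Suc i) \<le> t"
    proof
      assume "a (Suc i) \<le> t"
      then have "Suc i \<le> i"
        unfolding i_def by (intro Greatest_le_nat[where b = m]) (use im i_def in auto)
      then show False by simp
    qed
    then have it: "a i < t" "t < a i + p i"
      using i t im by (auto simp: a_Suc B_def less_le)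
    have low: "a k + p k < t" if "k < i" for k
      using a_mono[of "Suc k" i] that im it by (simp add: a_Suc)
    have high: "t < a k" if "i < k" "k < m" for k
      using a_mono[of "Suc i" k] that it by (simp add: a_Suc)
    have pos_k: "k < i \<Longrightarrow> 0 < p k" for k using pos im by simp
    have split: "X s = (\<Sum>k<i. ramp (a k) (p k) s) + ramp (a i) (p i) s
        + (\<Sum>k\<in>{i<..<m}. ramp (a k) (p k) s)" for s
    proof -
      have "{..<m} = ({..<i} \<union> {i}) \<union> {i<..<m}" using im by auto
      then have "X s = (\<Sum>k\<in>({..<i} \<union> {i}) \<union> {i<..<m}. ramp (a k) (p k) s)"
        unfolding X_def by simp
      also have "\<dots> = (\<Sum>k\<in>{..<i} \<union> {i}. ramp (a k) (p k) s)
          + (\<Sum>k\<in>{i<..<m}. ramp (a k) (p k) s)"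
        by (rule sum.union_disjoint) auto
      finally show ?thesis by simp
    qed
    have v1: "(\<Sum>k<i. ramp (a k) (p k) t) = real i"
    proof -
      have "ramp (a k) (p k) t = 1" if "k < i" for k
        using low[OF that] pos_k[OF that] by (simp add: ramp_def)
      then show ?thesis by simp
    qed
    have v2: "(\<Sum>k\<in>{i<..<m}. ramp (a k) (p k) t) = 0"
    proof (intro sum.neutral ballI)
      fix k assume "k \<in> {i<..<m}"
      then have "(t - a k) / p k \<le> 0" using high[of k] pos[of k] by (simp add: divide_nonpos_pos)
      then show "ramp (a k) (p k) t = 0" by (simp add: ramp_def)
    qed
    have "(X has_real_derivative (\<Sum>k<m. if k = i then 1 / p k else 0)) (at t)"
      unfolding X_def
    proof (intro DERIV_sum)
      fix k assume k: "k \<in> {..<m}"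
      have "(ramp (a k) (p k) has_real_derivative
          (if a k < t \<and> t < a k + p k then 1 / p k else 0)) (at t)"
        using k t pos[of k] by (intro ramp_derivative) (force simp: B_def simp flip: a_Suc)+
      moreover have "(a k < t \<and> t < a k + p k) \<longleftrightarrow> k = i"
        using it low[of k] high[of k] k by (cases k i rule: linorder_cases) auto
      ultimately show "((\<lambda>t. ramp (a k) (p k) t) has_real_derivative
          (if k = i then 1 / p k else 0)) (at t)" by simp
    qed
    then have "(X has_real_derivative 1 / p i) (at t)" using im by simp
    moreover have "0 \<le> ramp (a i) (p i) t" "ramp (a i) (p i) t \<le> 1" by (auto simp: ramp_def)
    ultimately show ?thesis using split[of t] v1 v2 im by (intro exI[of _ i]) auto
  qed
  show thesis
    by (rule that[of B X, OF _ cont X0 X1 main]) (auto simp: B_def)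
qed

text \<open>The shift by one absorbs the rounding when a step function on \<open>[0,m]\<close> is read as a function
  on \<open>{0..<m}\<close>; without it the transport inequality below fails by a factor above 1.\<close>

definition cost :: "nat \<Rightarrow> nat \<Rightarrow> nat \<Rightarrow> real" where
  "cost m i j = (max 0 (\<bar>real i - real j\<bar> - 1) / real m)\<^sup>2 / 5"

text \<open>The 5 in \<open>cost\<close> comes from here: the transport argument yields the factor
  \<open>1 + d^2/4\<close>, and the gap between 1/4 and 1/5 pays for turning it into an
  exponential.\<close>

lemma exp_fifth_le:
  fixes t :: real
  assumes "0 \<le> t" "t \<le> 1"
  shows "exp (t / 5) \<le> 1 + t / 4"
proof -
  have "exp (t / 5) \<le> 1 + t / 5 + (t / 5)\<^sup>2" using assms by (intro exp_bound) auto
  also have "(t / 5)\<^sup>2 \<le> t / 25" using assms mult_left_le[of t t] by (simp add: power2_eq_square)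
  finally show ?thesis using assms by linarith
qed

lemma square_root_le_weighted_sum:
  fixes p q x y c :: real
  assumes "0 \<le> p" "0 \<le> q" "0 \<le> x" "0 \<le> y" "c \<le> 4 * (p * q) * (x * y)"
  shows "sqrt c \<le> p * x + q * y"
proof -
  have "4 * (p * q) * (x * y) = (p * x + q * y)\<^sup>2 - (p * x - q * y)\<^sup>2"
    by (simp add: power2_eq_square algebra_simps)
  then have "c \<le> (p * x + q * y)\<^sup>2" using assms by (smt (verit) zero_le_power2)
  then show ?thesis using assms by (intro real_le_lsqrt) auto
qed

text \<open>This is Maurey's property (tau), the infimum-convolution form of a transport inequality,
  for the uniform measure on \<open>{..<m}\<close>. Unlike a direct isoperimetric statement, it
  passes to products by induction.\<close>

lemma discrete_transport_inequality:
  fixes u v :: "nat \<Rightarrow> real"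
  assumes m: "0 < m" and u: "\<And>i. i < m \<Longrightarrow> 0 < u i" and v: "\<And>i. i < m \<Longrightarrow> 0 < v i"
    and uv: "\<And>i j. i < m \<Longrightarrow> j < m \<Longrightarrow> u i * v j \<le> exp (cost m i j)"
  shows "(\<Sum>i<m. u i) * (\<Sum>j<m. v j) \<le> (real m)\<^sup>2"
proof -
  define I where "I = (\<Sum>i<m. u i)"
  define J where "J = (\<Sum>j<m. v j)"
  have I: "0 < I" unfolding I_def using m u by (intro sum_pos) auto
  have J: "0 < J" unfolding J_def using m v by (intro sum_pos) auto
  define G where "G = I * J / (real m)\<^sup>2"
  obtain X B where X: "finite B" "continuous_on {0..1} X" "X 0 = 0" "X 1 = real m"
    and X': "\<And>t. 0 < t \<Longrightarrow> t < 1 \<Longrightarrow> t \<notin> B \<Longrightarrow>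
      \<exists>i<m. real i \<le> X t \<and> X t \<le> real i + 1 \<and> (X has_real_derivative 1 / (u i / I)) (at t)"
  proof (rule step_density_quantile[of m "\<lambda>i. u i / I"])
    show "(\<Sum>i<m. u i / I) = 1" using I by (simp add: I_def flip: sum_divide_distrib)
  qed (use u I in auto)
  obtain Y C where Y: "finite C" "continuous_on {0..1} Y" "Y 0 = 0" "Y 1 = real m"
    and Y': "\<And>t. 0 < t \<Longrightarrow> t < 1 \<Longrightarrow> t \<notin> C \<Longrightarrow>
      \<exists>j<m. real j \<le> Y t \<and> Y t \<le> real j + 1 \<and> (Y has_real_derivative 1 / (v j / J)) (at t)"
  proof (rule step_density_quantile[of m "\<lambda>j. v j / J"])
    show "(\<Sum>j<m. v j / J) = 1" using J by (simp add: J_def flip: sum_divide_distrib)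
  qed (use v J in auto)
  define x where "x t = X t / m" for t
  define y where "y t = Y t / m" for t
  \<comment> \<open>Follow the monotone transport \<open>t \<mapsto> (x t, y t)\<close> between the two densities. The potential
    \<open>Z x y = (x + y)/2 + ((x + y)/2 - 1/2) (x - y)\<^sup>2/4\<close> goes from 0 to 1 along it and satisfies
    \<open>4 Z\<^sub>x Z\<^sub>y \<ge> exp ((x - y)\<^sup>2/5)\<close>, so by AM-GM it grows at rate at least \<open>sqrt G\<close>.\<close>
  define f where "f t = (x t + y t) / 2 + ((x t + y t) / 2 - 1 / 2) * (x t - y t)\<^sup>2 / 4 - sqrt G * t" for t
  have "f 0 \<le> f 1"
  proof (rule nondecreasing_finite_exceptions[of "B \<union> C" 0 1 f])
    show "finite (B \<union> C)" using X Y by simp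
    show "continuous_on {0..1} f"
      unfolding f_def x_def y_def using X(2) Y(2) m by (intro continuous_intros) auto
    fix t :: real assume t: "0 < t" "t < 1" "t \<notin> B \<union> C"
    obtain i where i: "i < m" "real i \<le> X t" "X t \<le> real i + 1"
      and dX: "(X has_real_derivative 1 / (u i / I)) (at t)" using X'[of t] t by auto
    obtain j where j: "j < m" "real j \<le> Y t" "Y t \<le> real j + 1"
      and dY: "(Y has_real_derivative 1 / (v j / J)) (at t)" using Y'[of t] t by auto
    define x' where "x' = I / (u i * m)"
    define y' where "y' = J / (v j * m)"
    have dx: "(x has_real_derivative x') (at t)"
      unfolding x_def x'_def using DERIV_cdivide[OF dX, of "real m"] by simp
    have dy: "(y has_real_derivative y') (at t)"
      unfolding y_def y'_def using DERIV_cdivide[OF dY, of "real m"] by simp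
    define d where "d = x t - y t"
    define g where "g = (x t + y t) / 2 - 1 / 2"
    \<comment> \<open>\<open>p\<close> and \<open>q\<close> are the partial derivatives of
      \<open>Z\<close> at the current point, while \<open>x'\<close> and \<open>y'\<close> are the
      speeds of the two curves.\<close>
    define p where "p = 1 / 2 + d\<^sup>2 / 8 + g * d / 2"
    define q where "q = 1 / 2 + d\<^sup>2 / 8 - g * d / 2"
    have df: "(f has_real_derivative (p * x' + q * y' - sqrt G)) (at t)"
      unfolding f_def
      by (rule derivative_eq_intros dx dy refl | simp)+
        (simp add: p_def q_def d_def g_def power2_eq_square field_simps)
    have xt: "0 \<le> x t" "x t \<le> 1" and yt: "0 \<le> y t" "y t \<le> 1"
      using i j m unfolding x_def y_def by (auto simp: field_simps)
    have d: "\<bar>d\<bar> \<le> 1" using xt yt unfolding d_def by linarith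
    have "- (1 / 2) \<le> g" "g \<le> 1 / 2" using xt yt by (simp_all add: g_def field_simps)
    then have g: "\<bar>g\<bar> \<le> 1 / 2" by linarith
    have gd: "\<bar>g * d\<bar> \<le> 1 / 2" using mult_mono[OF g d] by (simp add: abs_mult)
    have pq0: "0 \<le> p" "0 \<le> q"
      using gd zero_le_power2[of d] unfolding p_def q_def by linarith+
    have g2: "g\<^sup>2 \<le> 1 / 4" using power_mono[OF g, of 2] by (simp add: power2_eq_square)
    \<comment> \<open>\<open>4 p q = (1 + d^2/4)^2 - g^2 d^2\<close>, and
      \<open>|g| \<le> 1/2\<close> loses at most half of the gain \<open>d^2/2\<close>.\<close>
    have "1 + d\<^sup>2 / 4 \<le> 4 * (p * q)"
    proof -
      have "4 * (p * q) = 1 + d\<^sup>2 / 2 + (d\<^sup>2)\<^sup>2 / 16 - g\<^sup>2 * d\<^sup>2"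
        by (simp add: p_def q_def power2_eq_square field_simps)
      moreover have "g\<^sup>2 * d\<^sup>2 \<le> 1 / 4 * d\<^sup>2" using g2 by (intro mult_right_mono) auto
      ultimately show ?thesis using zero_le_power2[of "d\<^sup>2"] by linarith
    qed
    moreover have "exp (d\<^sup>2 / 5) \<le> 1 + d\<^sup>2 / 4"
      using d by (intro exp_fifth_le) (auto simp: abs_square_le_1)
    moreover have "cost m i j \<le> d\<^sup>2 / 5"
    proof -
      \<comment> \<open>Only the unit cells of \<open>X t\<close> and \<open>Y t\<close> are known,
        so their distance may be smaller than \<open>|i - j|\<close> by 1; the shift in
        \<open>cost\<close> accounts for this.\<close>
      have "max 0 (\<bar>real i - real j\<bar> - 1) \<le> \<bar>X t - Y t\<bar>" using i j by auto
      then have "max 0 (\<bar>real i - real j\<bar> - 1) / m \<le> \<bar>d\<bar>"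
        using m by (simp add: d_def x_def y_def field_simps flip: diff_divide_distrib)
      then have "(max 0 (\<bar>real i - real j\<bar> - 1) / m)\<^sup>2 \<le> \<bar>d\<bar>\<^sup>2"
        by (intro power_mono) auto
      then show ?thesis by (simp add: cost_def)
    qed
    ultimately have e: "u i * v j \<le> 4 * (p * q)"
      using uv[OF i(1) j(1)] by (smt (verit) exp_le_cancel_iff)
    have "G = u i * v j * (x' * y')"
      using u[OF i(1)] v[OF j(1)] m by (simp add: G_def x'_def y'_def field_simps power2_eq_square)
    also have "\<dots> \<le> 4 * (p * q) * (x' * y')"
      using e u[OF i(1)] v[OF j(1)] m I J by (intro mult_right_mono) (auto simp: x'_def y'_def)
    finally have "sqrt G \<le> p * x' + q * y'"
      using u[OF i(1)] v[OF j(1)] m I J pq0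
      by (intro square_root_le_weighted_sum) (auto simp: x'_def y'_def)
    then show "\<exists>D\<ge>0. (f has_real_derivative D) (at t)"
      using df by (intro exI[of _ "p * x' + q * y' - sqrt G"]) simp
  qed simp
  then have "sqrt G \<le> 1" using X Y m by (simp add: f_def x_def y_def)
  then show ?thesis using m by (simp add: G_def I_def J_def field_simps)
qed

section \<open>Concentration in the product space\<close>

definition configs :: "nat \<Rightarrow> nat \<Rightarrow> nat list set" where
  "configs m h = {xs. set xs \<subseteq> {..<m} \<and> length xs = h}"

lemma finite_configs [simp]: "finite (configs m h)"
  by (simp add: configs_def finite_lists_length_eq)

lemma card_configs: "card (configs m h) = m ^ h"
  by (simp add: configs_def card_lists_length_eq)

lemma configs_0 [simp]: "configs m 0 = {[]}"
  by (auto simp: configs_def)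

lemma Cons_in_configs [simp]: "a # xs \<in> configs m (Suc h) \<longleftrightarrow> a < m \<and> xs \<in> configs m h"
  by (auto simp: configs_def)

lemma nth_configs_less: "xs \<in> configs m h \<Longrightarrow> i < h \<Longrightarrow> xs ! i < m"
  unfolding configs_def using nth_mem by blast

lemma sum_configs_Suc:
  "(\<Sum>xs\<in>configs m (Suc h). F xs) = (\<Sum>a<m. \<Sum>xs\<in>configs m h. F (a # xs))"
proof -
  have "(\<Sum>xs\<in>configs m (Suc h). F xs) = (\<Sum>(xs, a)\<in>configs m h \<times> {..<m}. F (a # xs))"
    unfolding configs_def lists_length_Suc_eq
    by (subst sum.reindex) (auto simp: inj_on_def case_prod_unfold)
  also have "\<dots> = (\<Sum>xs\<in>configs m h. \<Sum>a<m. F (a # xs))"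
    by (simp add: sum.cartesian_product)
  also have "\<dots> = (\<Sum>a<m. \<Sum>xs\<in>configs m h. F (a # xs))"
    by (rule sum.swap)
  finally show ?thesis .
qed

lemma sum_nth_Cons:
  fixes f :: "nat \<Rightarrow> 'a::comm_monoid_add"
  shows "(\<Sum>i<Suc h. f ((x # xs) ! i)) = f x + (\<Sum>i<h. f (xs ! i))"
  by (simp add: sum.lessThan_Suc_shift del: sum.lessThan_Suc)

lemma sum_nth_Cons2:
  fixes f :: "nat \<Rightarrow> nat \<Rightarrow> 'a::comm_monoid_add"
  shows "(\<Sum>i<Suc h. f ((x # xs) ! i) ((y # ys) ! i)) = f x y + (\<Sum>i<h. f (xs ! i) (ys ! i))"
  by (simp add: sum.lessThan_Suc_shift del: sum.lessThan_Suc)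

text \<open>Tensorization: for fixed first coordinates \<open>a\<close>, \<open>b\<close> the
  induction hypothesis applies to the slices of \<open>u\<close> and \<open>v\<close>, one of them
  damped by \<open>exp (- cost m a b)\<close>. The slice averages \<open>U\<close>, \<open>V\<close>
  then satisfy the one-dimensional hypothesis.\<close>

lemma product_transport_inequality:
  fixes u v :: "nat list \<Rightarrow> real"
  assumes m: "0 < m"
    and "\<And>xs. xs \<in> configs m h \<Longrightarrow> 0 < u xs" and "\<And>xs. xs \<in> configs m h \<Longrightarrow> 0 < v xs"
    and "\<And>xs ys. xs \<in> configs m h \<Longrightarrow> ys \<in> configs m h \<Longrightarrow>
          u xs * v ys \<le> exp (\<Sum>i<h. cost m (xs ! i) (ys ! i))"
  shows "(\<Sum>xs\<in>configs m h. u xs) * (\<Sum>ys\<in>configs m h. v ys) \<le> (real m ^ h)\<^sup>2"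
  using assms(2-)
proof (induction h arbitrary: u v)
  case 0
  then show ?case by simp
next
  case (Suc h)
  have ne: "configs m h \<noteq> {}"
    using m card_configs[of m h] by (metis card.empty power_eq_0_iff less_numeral_extra(3))
  define U where "U a = (\<Sum>xs\<in>configs m h. u (a # xs)) / real m ^ h" for a
  define V where "V b = (\<Sum>ys\<in>configs m h. v (b # ys)) / real m ^ h" for b
  have "(\<Sum>a<m. U a) * (\<Sum>b<m. V b) \<le> (real m)\<^sup>2"
  proof (rule discrete_transport_inequality[OF m])
    show "0 < U a" if "a < m" for a
      unfolding U_def using that Suc.prems(1) m ne by (intro divide_pos_pos sum_pos) auto
    show "0 < V a" if "a < m" for a
      unfolding V_def using that Suc.prems(2) m ne by (intro divide_pos_pos sum_pos) auto
    fix a b assume ab: "a < m" "b < m"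
    have "(\<Sum>xs\<in>configs m h. u (a # xs)) * (\<Sum>ys\<in>configs m h. v (b # ys) * exp (- cost m a b))
        \<le> (real m ^ h)\<^sup>2"
    proof (rule Suc.IH)
      fix xs ys assume x: "xs \<in> configs m h" and y: "ys \<in> configs m h"
      have "u (a # xs) * v (b # ys) \<le> exp (cost m a b + (\<Sum>i<h. cost m (xs ! i) (ys ! i)))"
        using Suc.prems(3)[of "a # xs" "b # ys"] x y ab by (simp only: sum_nth_Cons2) simp
      then have "u (a # xs) * v (b # ys) * exp (- cost m a b)
          \<le> exp (cost m a b + (\<Sum>i<h. cost m (xs ! i) (ys ! i))) * exp (- cost m a b)"
        by (intro mult_right_mono) auto
      also have "\<dots> = exp (\<Sum>i<h. cost m (xs ! i) (ys ! i))"
        by (simp flip: exp_add)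
      finally show "u (a # xs) * (v (b # ys) * exp (- cost m a b))
          \<le> exp (\<Sum>i<h. cost m (xs ! i) (ys ! i))" by (simp add: mult.assoc)
    qed (use Suc.prems ab in auto)
    then have "U a * V b * exp (- cost m a b) \<le> 1"
      using m by (simp add: U_def V_def power2_eq_square field_simps flip: sum_distrib_right)
    then show "U a * V b \<le> exp (cost m a b)"
      by (simp add: exp_minus field_simps)
  qed
  then show ?case
    using m by (simp add: sum_configs_Suc U_def V_def power_mult_distrib field_simps power2_eq_square
        flip: sum_divide_distrib)
qed

text \<open>The transport inequality is tested on two-level functions, \<open>u\<close> with values
  1 and \<open>exp (- t)\<close>, \<open>v\<close> with values \<open>exp t\<close> and 1. Their
  product exceeds 1 only on \<open>A \<times> A'\<close>, where separation allows the value
  \<open>exp t\<close>.\<close>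

lemma separated_configs_card:
  assumes m: "0 < m" and t: "0 \<le> t" and A: "A \<subseteq> configs m h" and A': "A' \<subseteq> configs m h"
    and sep: "\<And>xs ys. xs \<in> A \<Longrightarrow> ys \<in> A' \<Longrightarrow> t \<le> (\<Sum>i<h. cost m (xs ! i) (ys ! i))"
  shows "real (card A) * real (card A') \<le> (real m ^ h)\<^sup>2 * exp (- t)"
proof -
  define u where "u xs = (if xs \<in> A then 1 else exp (- t))" for xs
  define v where "v xs = (if xs \<in> A' then exp t else 1)" for xs
  have cost0: "0 \<le> (\<Sum>i<h. cost m (xs ! i) (ys ! i))" for xs ys
    by (intro sum_nonneg) (simp add: cost_def)
  have "(\<Sum>xs\<in>configs m h. u xs) * (\<Sum>ys\<in>configs m h. v ys) \<le> (real m ^ h)\<^sup>2"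
  proof (rule product_transport_inequality[OF m])
    fix xs ys
    have "exp (-t) \<le> 1" using t by simp
    then show "u xs * v ys \<le> exp (\<Sum>i<h. cost m (xs ! i) (ys ! i))"
      using sep[of xs ys] cost0[of xs ys] order_trans[OF \<open>exp (-t) \<le> 1\<close>, of "exp (\<Sum>i<h. cost m (xs ! i) (ys ! i))"]
      by (auto simp: u_def v_def simp flip: exp_add)
  qed (auto simp: u_def v_def)
  moreover have "real (card A) \<le> (\<Sum>xs\<in>configs m h. u xs)"
  proof -
    have "real (card A) = (\<Sum>xs\<in>A. u xs)" by (simp add: u_def)
    also have "\<dots> \<le> (\<Sum>xs\<in>configs m h. u xs)"
      using A by (intro sum_mono2) (auto simp: u_def)
    finally show ?thesis .
  qed
  moreover have "real (card A') * exp t \<le> (\<Sum>xs\<in>configs m h. v xs)"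
  proof -
    have "real (card A') * exp t = (\<Sum>xs\<in>A'. v xs)" by (simp add: v_def)
    also have "\<dots> \<le> (\<Sum>xs\<in>configs m h. v xs)"
      using A' by (intro sum_mono2) (auto simp: v_def)
    finally show ?thesis .
  qed
  ultimately have "real (card A) * (real (card A') * exp t) \<le> (real m ^ h)\<^sup>2"
    by (smt (verit) mult_mono of_nat_0_le_iff mult_nonneg_nonneg exp_ge_zero)
  then show ?thesis by (simp add: exp_minus field_simps)
qed

section \<open>Anticoncentration of inner products\<close>

text \<open>\<open>window \<nu> N t\<close> is the probability that \<open>t\<close> plus a sum of \<open>N\<close> random signs lies in \<open>[-\<nu>, \<nu>]\<close>.\<close>

fun window :: "real \<Rightarrow> nat \<Rightarrow> real \<Rightarrow> real" where
  "window \<nu> 0 t = (if \<bar>t\<bar> \<le> \<nu> then 1 else 0)"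
| "window \<nu> (Suc N) t = (window \<nu> N (t - 1) + window \<nu> N (t + 1)) / 2"

lemma sum_binomial_Suc:
  fixes g :: "nat \<Rightarrow> real"
  shows "(\<Sum>k\<le>Suc n. real (Suc n choose k) * g k)
    = (\<Sum>k\<le>n. real (n choose k) * g k) + (\<Sum>k\<le>n. real (n choose k) * g (Suc k))"
proof -
  have "(\<Sum>k\<le>Suc n. real (n choose k) * g k) = g 0 + (\<Sum>k\<le>n. real (n choose Suc k) * g (Suc k))"
    by (subst sum.atMost_Suc_shift) simp
  then show ?thesis
    by (subst sum.atMost_Suc_shift) (simp add: distrib_right sum.distrib binomial_eq_0)
qed

lemma window_binomial:
  "window \<nu> N t * 2 ^ N = (\<Sum>k\<le>N. real (N choose k) * window \<nu> 0 (t + real N - 2 * real k))"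
proof (induction N arbitrary: t)
  case (Suc N)
  have "window \<nu> (Suc N) t * 2 ^ Suc N = window \<nu> N (t + 1) * 2 ^ N + window \<nu> N (t - 1) * 2 ^ N"
    by (simp add: algebra_simps)
  also have "\<dots> = (\<Sum>k\<le>Suc N. real (Suc N choose k) * window \<nu> 0 (t + real (Suc N) - 2 * real k))"
    unfolding Suc.IH sum_binomial_Suc by (simp add: algebra_simps)
  finally show ?case .
qed simp

text \<open>The bound \<open>4^k / sqrt (2k + 1)\<close> is squared so that the induction stays
  rational: consecutive terms have ratio \<open>4 (2k + 1)(2k + 3)/(k + 1)^2\<close>, which is at
  most 16.\<close>

lemma central_binomial_upper: "real (2 * k choose k) ^ 2 * (2 * real k + 1) \<le> 16 ^ k"
proof (induction k)
  case (Suc k)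
  have "(Suc k) * (2 * Suc k choose Suc k) = 2 * (2 * k + 1) * (2 * k choose k)"
  proof -
    have a: "Suc k * (Suc (Suc (2 * k)) choose Suc k) = Suc (Suc (2 * k)) * (Suc (2 * k) choose k)"
      by (rule Suc_times_binomial)
    have b: "Suc k * (Suc (2 * k) choose Suc k) = Suc (2 * k) * (2 * k choose k)"
      by (rule Suc_times_binomial)
    have "(Suc (2 * k) choose k) = (Suc (2 * k) choose Suc k)"
      by (subst binomial_symmetric) auto
    then have "Suc k * (Suc (Suc (2 * k)) choose Suc k) = 2 * (Suc k * (Suc (2 * k) choose Suc k))"
      using a by simp
    then show ?thesis using b by simp
  qed
  then have "real (Suc k) * real (2 * Suc k choose Suc k) = 2 * (2 * real k + 1) * real (2 * k choose k)"
    by (metis (mono_tags, lifting) of_nat_1 of_nat_add of_nat_mult of_nat_numeral)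
  then have e: "real (2 * Suc k choose Suc k) = 2 * (2 * real k + 1) * real (2 * k choose k) / (real k + 1)"
    by (simp add: field_simps)
  have "real (2 * Suc k choose Suc k) ^ 2 * (2 * real (Suc k) + 1)
     = real (2 * k choose k) ^ 2 * (2 * real k + 1) * (4 * (2 * real k + 1) * (2 * real k + 3) / (real k + 1)\<^sup>2)"
    unfolding e by (simp add: power2_eq_square field_simps)
  also have "\<dots> \<le> 16 ^ k * 16"
  proof (rule mult_mono[OF Suc.IH])
    have "4 * (2 * real k + 1) * (2 * real k + 3) \<le> 16 * (real k + 1)\<^sup>2"
      by (simp add: power2_eq_square algebra_simps)
    then show "4 * (2 * real k + 1) * (2 * real k + 3) / (real k + 1)\<^sup>2 \<le> 16"
      by (simp add: divide_le_eq)
  qed auto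
  finally show ?case by simp
qed simp

lemma binomial_le_two_power_div_sqrt: "real (N choose k) \<le> 2 ^ N / sqrt (real N + 1)"
proof -
  have "real (N choose (N div 2)) ^ 2 * (real N + 1) \<le> (2 ^ N)\<^sup>2"
  proof (cases "even N")
    case True
    then obtain j where "N = 2 * j" by blast
    then show ?thesis using central_binomial_upper[of j] by (simp add: power_mult power2_eq_square flip: power_mult_distrib)
  next
    case False
    then obtain j where N: "N = Suc (2 * j)" using oddE by fastforce
    have "(Suc (2 * j) choose j) = (Suc (2 * j) choose Suc j)"
      by (subst binomial_symmetric) auto
    \<comment> \<open>An odd row reduces to the next even row, whose central coefficient is twice
      the largest one of row \<open>N\<close>.\<close>
    then have "(2 * Suc j choose Suc j) = 2 * (N choose j)" by (simp add: N)
    then have "(2 * real (N choose j)) ^ 2 * (2 * real (Suc j) + 1) \<le> 16 ^ Suc j"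
      using central_binomial_upper[of "Suc j"] by simp
    moreover have "(2 ^ N)\<^sup>2 * 4 = (16::real) ^ Suc j"
      by (simp add: N power_mult power2_eq_square flip: power_mult_distrib)
    moreover have "N div 2 = j" by (simp add: N)
    moreover have "real (N choose j) ^ 2 * (real N + 1) \<le> real (N choose j) ^ 2 * (2 * real (Suc j) + 1)"
      by (intro mult_left_mono) (auto simp: N)
    ultimately show ?thesis by (simp add: power_mult_distrib)
  qed
  then have "(real (N choose (N div 2)) * sqrt (real N + 1))\<^sup>2 \<le> (2 ^ N)\<^sup>2"
    by (simp add: power_mult_distrib)
  then have "real (N choose (N div 2)) * sqrt (real N + 1) \<le> 2 ^ N"
    by (rule power2_le_imp_le) simp
  then have "real (N choose (N div 2)) \<le> 2 ^ N / sqrt (real N + 1)"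
    by (simp add: pos_le_divide_eq add_pos_nonneg add_nonneg_pos)
  then show ?thesis
    using binomial_maximum[of N k] by (smt (verit) of_nat_mono)
qed

lemma card_nat_set_in_interval:
  fixes K :: "nat set" and a l :: real
  assumes "finite K" "0 \<le> l" and "\<And>k. k \<in> K \<Longrightarrow> a \<le> real k \<and> real k \<le> a + l"
  shows "real (card K) \<le> l + 1"
proof (cases "K = {}")
  case False
  have "K \<subseteq> {Min K..Max K}" using assms(1) by auto
  then have "card K \<le> Suc (Max K) - Min K" using card_mono[of "{Min K..Max K}" K] by simp
  moreover have "Min K \<le> Max K" using assms(1) False by simp
  moreover have "a \<le> real (Min K)" "real (Max K) \<le> a + l"
    using assms Min_in[OF assms(1) False] Max_in[OF assms(1) False] by auto
  ultimately show ?thesis by linarith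
qed (use assms in simp)

text \<open>The Littlewood-Offord count: with \<open>k\<close> negative signs the sum is
  \<open>t + N - 2k\<close>, so \<open>k\<close> is confined to an interval of length
  \<open>\<nu>\<close>, and each admissible \<open>k\<close> has at most the central binomial
  probability.\<close>

lemma window_le:
  assumes "0 \<le> \<nu>"
  shows "window \<nu> N t \<le> (\<nu> + 1) / sqrt (real N + 1)"
proof -
  define K where "K = {k. k \<le> N \<and> \<bar>t + real N - 2 * real k\<bar> \<le> \<nu>}"
  have fK: "finite K" by (rule finite_subset[of _ "{..N}"]) (auto simp: K_def)
  have "real (card K) \<le> \<nu> + 1"
    by (rule card_nat_set_in_interval[OF fK assms, of "(t + real N - \<nu>) / 2"])
      (auto simp: K_def abs_le_iff field_simps)
  have "window \<nu> N t * 2 ^ N = (\<Sum>k\<in>K. real (N choose k))"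
    unfolding window_binomial K_def
    by (simp add: sum.If_cases if_distrib Int_def cong: if_cong)
  also have "\<dots> \<le> real (card K) * (2 ^ N / sqrt (real N + 1))"
    by (rule sum_bounded_above) (rule binomial_le_two_power_div_sqrt)
  also have "\<dots> \<le> (\<nu> + 1) * (2 ^ N / sqrt (real N + 1))"
    using \<open>real (card K) \<le> \<nu> + 1\<close> by (intro mult_right_mono) auto
  finally have "window \<nu> N t * 2 ^ N \<le> (\<nu> + 1) / sqrt (real N + 1) * 2 ^ N" by simp
  then show ?thesis by (rule mult_right_le_imp_le) simp
qed

text \<open>The induction step for bounding the mean of \<open>1/(N + 1 + B)\<close> with \<open>B\<close> binomial of parameters
  \<open>h\<close> and \<open>p\<close> by \<open>1/(N + 1 + p h/2)\<close>.\<close>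

lemma reciprocal_mixture_le:
  fixes A p :: real
  assumes "1 \<le> A" "0 \<le> p" "p \<le> 1"
  shows "(1 - p) / A + p / (A + 1) \<le> 1 / (A + p / 2)"
proof -
  have "(A + (1 - p)) * (A + p / 2) \<le> A * (A + 1)"
  proof -
    have "A * (A + 1) - (A + (1 - p)) * (A + p / 2) = p / 2 * (A - 1 + p)"
      by (simp add: field_simps)
    then show ?thesis using assms mult_nonneg_nonneg[of "p / 2" "A - 1 + p"] by linarith
  qed
  moreover have "(1 - p) / A + p / (A + 1) = (A + (1 - p)) / (A * (A + 1))"
    using assms by (simp add: field_simps)
  moreover have "0 < A + p / 2" "0 < A * (A + 1)" using assms by (auto intro: add_pos_nonneg)
  ultimately show ?thesis by (simp only: divide_le_eq le_divide_eq) (simp add: mult.commute)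
qed

section \<open>The truncated coordinate map and its inner products\<close>

definition coord :: "nat \<Rightarrow> nat \<Rightarrow> real" where
  "coord r x = max (- 1) (min 1 ((2 * real x + 1 - 4 * real r) / (2 * real r)))"

lemma coord_left: "x < r \<Longrightarrow> coord r x = - 1"
  by (simp add: coord_def min_def max_def field_simps)

lemma coord_right:
  assumes "0 < r" "3 * r \<le> x"
  shows "coord r x = 1"
proof -
  have "3 * real r \<le> real x" using assms(2) by linarith
  then show ?thesis using assms(1) by (simp add: coord_def min_def max_def field_simps)
qed

text \<open>The ramp in \<open>coord\<close> is centred at the half-integer \<open>2r - 1/2\<close>,
  the midpoint of \<open>{0..<4r}\<close>, so reversing the indices is the discrete antipodal
  map.\<close>

lemma coord_reflect:
  assumes "x < 4 * r"
  shows "coord r (4 * r - 1 - x) = - coord r x"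
proof -
  have e: "real (4 * r - 1 - x) = 4 * real r - 1 - real x" using assms by linarith
  have "(2 * (4 * real r - 1 - real x) + 1 - 4 * real r) / (2 * real r)
      = - ((2 * real x + 1 - 4 * real r) / (2 * real r))"
    unfolding minus_divide_left by (rule arg_cong[where f = "\<lambda>z. z / (2 * real r)"]) simp
  then show ?thesis unfolding coord_def e by (simp add: min_def max_def)
qed

lemma coord_lipschitz: "\<bar>coord r x - coord r y\<bar> \<le> \<bar>real x - real y\<bar> / real r"
proof -
  have "\<bar>coord r x - coord r y\<bar>
      \<le> \<bar>(2 * real x + 1 - 4 * real r) / (2 * real r) - (2 * real y + 1 - 4 * real r) / (2 * real r)\<bar>"
    unfolding coord_def by linarith
  also have "(2 * real x + 1 - 4 * real r) / (2 * real r) - (2 * real y + 1 - 4 * real r) / (2 * real r)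
      = (2 * (real x - real y)) / (2 * real r)"
    unfolding diff_divide_distrib[symmetric] by simp
  also have "\<bar>\<dots>\<bar> = \<bar>real x - real y\<bar> / real r"
    by (simp add: abs_divide abs_mult del: right_diff_distrib_numeral)
  finally show ?thesis .
qed

text \<open>On these indices the coordinate is exactly \<open>-1\<close> or \<open>1\<close>.\<close>

definition flat :: "nat \<Rightarrow> nat set" where
  "flat r = {..<r} \<union> {3 * r..<4 * r}"

lemma sum_flat:
  fixes H :: "real \<Rightarrow> real"
  assumes "0 < r"
  shows "(\<Sum>b\<in>flat r. H (coord r b)) = real r * (H (- 1) + H 1)"
proof -
  have "(\<Sum>b\<in>flat r. H (coord r b)) = (\<Sum>b<r. H (coord r b)) + (\<Sum>b=3*r..<4*r. H (coord r b))"
    unfolding flat_def by (rule sum.union_disjoint) auto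
  also have "(\<Sum>b<r. H (coord r b)) = (\<Sum>b<r. H (- 1))"
    by (rule sum.cong) (auto simp: coord_left)
  also have "(\<Sum>b=3*r..<4*r. H (coord r b)) = (\<Sum>b=3*r..<4*r. H 1)"
    using assms by (intro sum.cong) (auto simp: coord_right)
  finally show ?thesis by (simp add: algebra_simps)
qed

lemma card_flat: "card (flat r) = 2 * r"
  unfolding flat_def by (subst card_Un_disjoint) auto

lemma flat_subset: "flat r \<subseteq> {..<4 * r}"
  by (auto simp: flat_def)

lemma finite_flat [simp]: "finite (flat r)"
  by (simp add: flat_def)

text \<open>A quarter of all index pairs lies in \<open>flat r \<times> flat r\<close>, where the
  product is 1 and -1 equally often, that is, a random sign. The other \<open>12 r^2\<close> pairs
  get only the trivial bound.\<close>

lemma sum_coord_product_le: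
  fixes G :: "real \<Rightarrow> real"
  assumes r: "0 < r" and M: "\<And>t. G t \<le> M"
  shows "(\<Sum>a<4*r. \<Sum>b<4*r. G (coord r a * coord r b))
    \<le> 12 * (real r)\<^sup>2 * M + 2 * (real r)\<^sup>2 * (G (- 1) + G 1)"
proof -
  define P where "P = {..<4*r} \<times> {..<4*r}"
  define F where "F = flat r \<times> flat r"
  define g where "g = (\<lambda>(a, b). G (coord r a * coord r b))"
  have FP: "F \<subseteq> P" "finite P" "finite F"
    using flat_subset[of r] by (auto simp: F_def P_def)
  have "(\<Sum>a<4*r. \<Sum>b<4*r. G (coord r a * coord r b)) = sum g P"
    by (simp add: g_def P_def sum.cartesian_product)
  also have "\<dots> = sum g (P - F) + sum g F"
    using FP by (intro sum.subset_diff)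
  also have "sum g (P - F) \<le> real (card (P - F)) * M"
    by (rule sum_bounded_above) (auto simp: g_def M)
  also have "card (P - F) = 12 * r\<^sup>2"
    using FP by (simp add: card_Diff_subset) (simp add: P_def F_def card_flat power2_eq_square)
  also have "sum g F = (\<Sum>a\<in>flat r. \<Sum>b\<in>flat r. G (coord r a * coord r b))"
    by (simp add: g_def F_def sum.cartesian_product)
  also have "\<dots> = real r * (real r * (G 1 + G (- 1)) + real r * (G (- 1) + G 1))"
    by (simp only: sum_flat[OF r, where H = "\<lambda>z. G (_ * z)"]
        sum_flat[OF r, where H = "\<lambda>z. real r * (G (z * - 1) + G (z * 1))"]) simp
  finally show ?thesis by (simp add: power2_eq_square algebra_simps)
qed

definition dot :: "nat \<Rightarrow> nat \<Rightarrow> nat list \<Rightarrow> nat list \<Rightarrow> real" where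
  "dot r h xs ys = (\<Sum>i<h. coord r (xs ! i) * coord r (ys ! i))"

lemma dot_Cons: "dot r (Suc h) (x # xs) (y # ys) = coord r x * coord r y + dot r h xs ys"
  unfolding dot_def by (rule sum_nth_Cons2)

lemma sum_pairs_Suc:
  "(\<Sum>xs\<in>configs m (Suc h). \<Sum>ys\<in>configs m (Suc h). F xs ys)
    = (\<Sum>a<m. \<Sum>b<m. \<Sum>xs\<in>configs m h. \<Sum>ys\<in>configs m h. F (a # xs) (b # ys))"
proof -
  have "(\<Sum>xs\<in>configs m h. \<Sum>b<m. \<Sum>ys\<in>configs m h. F (a # xs) (b # ys))
      = (\<Sum>b<m. \<Sum>xs\<in>configs m h. \<Sum>ys\<in>configs m h. F (a # xs) (b # ys))" for a
    by (rule sum.swap)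
  then show ?thesis by (simp add: sum_configs_Suc)
qed

text \<open>Each coordinate contributes a random sign with probability 1/4 and an arbitrary shift
  otherwise, so induction over \<open>h\<close> with \<open>N\<close> and \<open>t\<close> general
  collects \<open>N\<close> plus a binomial number of signs. The bound \<open>1/sqrt (N + 1)\<close>
  is replaced by an affine function of \<open>1/(N + 1)\<close>, whose mean
  \<open>reciprocal_mixture_le\<close> controls.\<close>

lemma sum_window_dot_le:
  assumes r: "0 < r" and \<nu>: "0 \<le> \<nu>" and c: "0 < c"
  shows "(\<Sum>xs\<in>configs (4*r) h. \<Sum>ys\<in>configs (4*r) h. window \<nu> N (t + dot r h xs ys))
    \<le> (real (4*r) ^ h)\<^sup>2 * ((\<nu> + 1) * ((c / (real N + 1 + real h / 8) + 1 / c) / 2))"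
proof (induction h arbitrary: N t)
  case 0
  define s where "s = sqrt (real N + 1)"
  have s: "0 < s" "s\<^sup>2 = real N + 1" by (auto simp: s_def)
  \<comment> \<open>AM-GM with the free weight \<open>c\<close>, kept fixed through the induction
    and optimized only afterwards.\<close>
  have "(c / s - 1)\<^sup>2 / c \<ge> 0" using c by simp
  moreover have "(c / s - 1)\<^sup>2 / c = c / s\<^sup>2 - 2 / s + 1 / c"
    using c s(1) by (simp add: power2_eq_square field_simps)
  ultimately have "1 / s \<le> (c / s\<^sup>2 + 1 / c) / 2" by simp
  then have "1 / sqrt (real N + 1) \<le> (c / (real N + 1) + 1 / c) / 2"
    by (simp only: s_def[symmetric] s(2))
  then have "(\<nu> + 1) * (1 / sqrt (real N + 1)) \<le> (\<nu> + 1) * ((c / (real N + 1) + 1 / c) / 2)"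
    using \<nu> by (intro mult_left_mono) auto
  then have "window \<nu> N t \<le> (\<nu> + 1) * ((c / (real N + 1) + 1 / c) / 2)"
    using window_le[OF \<nu>, of N t] by (simp only: times_divide_eq_right mult_1_right)
  then show ?case by (simp add: dot_def)
next
  case (Suc h)
  define D where "D N h = (\<nu> + 1) * ((c / (real N + 1 + real h / 8) + 1 / c) / 2)" for N h
  define m where "m = 4 * r"
  define T where "T N t = (\<Sum>xs\<in>configs m h. \<Sum>ys\<in>configs m h. window \<nu> N (t + dot r h xs ys))" for N t
  have IH: "T N t \<le> (real m ^ h)\<^sup>2 * D N h" for N t
    using Suc.IH[of N t] by (simp add: T_def D_def m_def)
  have T_Suc: "T N (t - 1) + T N (t + 1) = 2 * T (Suc N) t"
  proof -
    have "2 * window \<nu> (Suc N) (t + d) = window \<nu> N (t - 1 + d) + window \<nu> N (t + 1 + d)" for d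
      by (simp add: algebra_simps)
    then show ?thesis by (simp only: T_def sum_distrib_left sum.distrib)
  qed
  have "(\<Sum>xs\<in>configs m (Suc h). \<Sum>ys\<in>configs m (Suc h). window \<nu> N (t + dot r (Suc h) xs ys))
      = (\<Sum>a<4*r. \<Sum>b<4*r. T N (t + coord r a * coord r b))"
    by (simp add: sum_pairs_Suc dot_Cons T_def m_def add.assoc)
  also have "\<dots> \<le> 12 * (real r)\<^sup>2 * ((real m ^ h)\<^sup>2 * D N h) + 2 * (real r)\<^sup>2 * (T N (t + - 1) + T N (t + 1))"
    by (rule sum_coord_product_le[OF r, where G = "\<lambda>s. T N (t + s)"]) (rule IH)
  also have "\<dots> = 12 * (real r)\<^sup>2 * ((real m ^ h)\<^sup>2 * D N h) + 4 * (real r)\<^sup>2 * T (Suc N) t"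
    using T_Suc by simp
  also have "\<dots> \<le> 12 * (real r)\<^sup>2 * ((real m ^ h)\<^sup>2 * D N h) + 4 * (real r)\<^sup>2 * ((real m ^ h)\<^sup>2 * D (Suc N) h)"
    using IH[of "Suc N" t] by (intro add_left_mono mult_left_mono) auto
  also have "\<dots> = (real m ^ Suc h)\<^sup>2 * (3 / 4 * D N h + 1 / 4 * D (Suc N) h)"
    by (simp add: m_def power2_eq_square field_simps)
  also have "\<dots> \<le> (real m ^ Suc h)\<^sup>2 * D N (Suc h)"
  proof (rule mult_left_mono)
    define A where "A = real N + 1 + real h / 8"
    \<comment> \<open>Here \<open>p = 1/4\<close> is the share of flat pairs; the gain
      \<open>p/2\<close> per coordinate is the 1/8 multiplying \<open>h\<close>.\<close>
    have "(1 - 1 / 4) / A + (1 / 4) / (A + 1) \<le> 1 / (A + 1 / 4 / 2)"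
      by (rule reciprocal_mixture_le) (auto simp: A_def)
    then have "3 / 4 * (1 / A) + 1 / 4 * (1 / (A + 1)) \<le> 1 / (A + 1 / 8)" by simp
    from mult_left_mono[OF this, of c]
    have "3 / 4 * (c / A) + 1 / 4 * (c / (A + 1)) \<le> c / (A + 1 / 8)"
      using c by (simp add: algebra_simps)
    moreover have "D N h = (\<nu> + 1) * ((c / A + 1 / c) / 2)"
      "D (Suc N) h = (\<nu> + 1) * ((c / (A + 1) + 1 / c) / 2)"
      "D N (Suc h) = (\<nu> + 1) * ((c / (A + 1 / 8) + 1 / c) / 2)"
      by (simp_all add: D_def A_def add.commute add.left_commute add_divide_distrib[of 1 "real h"])
    moreover have "3 / 4 * ((\<nu> + 1) * ((x + z) / 2)) + 1 / 4 * ((\<nu> + 1) * ((y + z) / 2))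
        = (\<nu> + 1) * ((3 / 4 * x + 1 / 4 * y + z) / 2)" for x y z :: real
      by (simp add: field_simps)
    ultimately show "3 / 4 * D N h + 1 / 4 * D (Suc N) h \<le> D N (Suc h)"
      using \<nu> by (simp only:) (intro mult_left_mono divide_right_mono, auto)
  qed simp
  finally show ?case by (simp add: m_def D_def)
qed

lemma card_dot_window_le:
  assumes r: "0 < r" and h: "0 < h" and \<nu>: "0 \<le> \<nu>"
  shows "real (card {(xs, ys) \<in> configs (4*r) h \<times> configs (4*r) h. \<bar>dot r h xs ys\<bar> \<le> \<nu>})
    \<le> (real (4*r) ^ h)\<^sup>2 * (3 * (\<nu> + 1) / sqrt (real h))"
proof -
  define m where "m = 4 * r"
  \<comment> \<open>This weight balances \<open>c / (h/8)\<close> against \<open>1 / c\<close>, and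
    \<open>sqrt 8 \<le> 3\<close> gives the constant 3.\<close>
  define c where "c = sqrt (real h / 8)"
  have c: "0 < c" using h by (simp add: c_def)
  have "real (card {(xs, ys) \<in> configs m h \<times> configs m h. \<bar>dot r h xs ys\<bar> \<le> \<nu>})
      = (\<Sum>(xs, ys)\<in>configs m h \<times> configs m h. window \<nu> 0 (0 + dot r h xs ys))"
    by (simp add: case_prod_unfold sum.If_cases Int_def mem_Times_iff conj_assoc)
  also have "\<dots> = (\<Sum>xs\<in>configs m h. \<Sum>ys\<in>configs m h. window \<nu> 0 (0 + dot r h xs ys))"
    by (simp add: sum.cartesian_product)
  also have "\<dots> \<le> (real m ^ h)\<^sup>2 * ((\<nu> + 1) * ((c / (real 0 + 1 + real h / 8) + 1 / c) / 2))"
    unfolding m_def by (rule sum_window_dot_le[OF r \<nu> c])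
  also have "\<dots> \<le> (real m ^ h)\<^sup>2 * ((\<nu> + 1) * (3 / sqrt (real h)))"
  proof (intro mult_left_mono)
    have "c / (real 0 + 1 + real h / 8) \<le> c / (real h / 8)"
      using h c by (intro divide_left_mono) auto
    also have "\<dots> = 1 / c"
      using c h by (simp add: c_def real_div_sqrt field_simps)
    finally have "(c / (real 0 + 1 + real h / 8) + 1 / c) / 2 \<le> 1 / c" by simp
    also have "1 / c = sqrt 8 / sqrt (real h)" by (simp add: c_def real_sqrt_divide)
    also have "\<dots> \<le> 3 / sqrt (real h)"
      by (intro divide_right_mono real_le_lsqrt) auto
    finally show "(c / (real 0 + 1 + real h / 8) + 1 / c) / 2 \<le> 3 / sqrt (real h)" .
  qed (use \<nu> in auto)
  finally show ?thesis by (simp add: m_def mult.commute[of 3])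
qed

section \<open>Reflection symmetry and the cross density\<close>

definition reflect :: "nat \<Rightarrow> nat list \<Rightarrow> nat list" where
  "reflect r xs = map (\<lambda>x. 4 * r - 1 - x) xs"

lemma reflect_in_configs: "xs \<in> configs (4*r) h \<Longrightarrow> reflect r xs \<in> configs (4*r) h"
  by (auto simp: configs_def reflect_def)

lemma reflect_reflect: "xs \<in> configs (4*r) h \<Longrightarrow> reflect r (reflect r xs) = xs"
  by (auto simp: configs_def reflect_def intro!: map_idI)

lemma inj_on_reflect: "inj_on (reflect r) (configs (4*r) h)"
  by (rule inj_on_inverseI) (rule reflect_reflect)

lemma coord_reflect_nth:
  assumes "xs \<in> configs (4*r) h" "i < h"
  shows "coord r (reflect r xs ! i) = - coord r (xs ! i)"
proof -
  have "reflect r xs ! i = 4 * r - 1 - xs ! i"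
    using assms by (simp add: reflect_def configs_def)
  then show ?thesis using coord_reflect[OF nth_configs_less[OF assms]] by (simp only:)
qed

lemma dot_reflect: "xs \<in> configs (4*r) h \<Longrightarrow> dot r h (reflect r xs) ys = - dot r h xs ys"
  by (simp add: dot_def coord_reflect_nth sum_negf)

text \<open>Reflecting the first point negates the inner product, so values below
  \<open>- \<nu>\<close> are no more frequent than values above \<open>\<nu>\<close>. Outside the
  window at least half of the pairs are therefore good.\<close>

lemma card_dot_greater_ge:
  assumes r: "0 < r" and h: "0 < h" and \<nu>: "0 \<le> \<nu>"
  shows "(real (4*r) ^ h)\<^sup>2 * (1 / 2 - 3 / 2 * (\<nu> + 1) / sqrt (real h))
    \<le> real (card {(xs, ys) \<in> configs (4*r) h \<times> configs (4*r) h. \<nu> < dot r h xs ys})"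
proof -
  define C where "C = configs (4*r) h"
  define P where "P = {(xs, ys) \<in> C \<times> C. \<nu> < dot r h xs ys}"
  define Q where "Q = {(xs, ys) \<in> C \<times> C. dot r h xs ys < - \<nu>}"
  define W where "W = {(xs, ys) \<in> C \<times> C. \<bar>dot r h xs ys\<bar> \<le> \<nu>}"
  have fin: "finite (C \<times> C)" by (simp add: C_def)
  have "card Q \<le> card P"
  proof (rule card_inj_on_le[where f = "map_prod (reflect r) id"])
    show "inj_on (map_prod (reflect r) id) Q"
      using inj_on_reflect[of r h] by (auto simp: inj_on_def Q_def C_def)
    show "map_prod (reflect r) id ` Q \<subseteq> P"
      by (auto simp: Q_def P_def C_def reflect_in_configs dot_reflect)
    show "finite P" by (rule finite_subset[OF _ fin]) (auto simp: P_def)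
  qed
  have "C \<times> C \<subseteq> P \<union> Q \<union> W" by (auto simp: P_def Q_def W_def)
  then have "card (C \<times> C) \<le> card (P \<union> Q \<union> W)"
    by (intro card_mono finite_subset[OF _ fin]) (auto simp: P_def Q_def W_def)
  also have "\<dots> \<le> card P + card Q + card W"
    by (meson add_right_mono card_Un_le order_trans)
  finally have "card (C \<times> C) \<le> 2 * card P + card W" using \<open>card Q \<le> card P\<close> by simp
  moreover have "real (card (C \<times> C)) = (real (4*r) ^ h)\<^sup>2"
    by (simp add: C_def card_cartesian_product card_configs power2_eq_square)
  moreover have "real (card W) \<le> (real (4*r) ^ h)\<^sup>2 * (3 * (\<nu> + 1) / sqrt (real h))"
    unfolding W_def C_def by (rule card_dot_window_le[OF r h \<nu>])
  ultimately have *: "(real (4*r) ^ h)\<^sup>2 \<le> 2 * real (card P) + (real (4*r) ^ h)\<^sup>2 * (3 * (\<nu> + 1) / sqrt (real h))"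
    by linarith
  have "M * (1 / 2 - 3 / 2 * (\<nu> + 1) / s) = (M - M * (3 * (\<nu> + 1) / s)) / 2" for M s
    by (simp add: right_diff_distrib diff_divide_distrib)
  then have "(real (4*r) ^ h)\<^sup>2 * (1 / 2 - 3 / 2 * (\<nu> + 1) / sqrt (real h))
      = ((real (4*r) ^ h)\<^sup>2 - (real (4*r) ^ h)\<^sup>2 * (3 * (\<nu> + 1) / sqrt (real h))) / 2" .
  also have "\<dots> \<le> real (card P)" using * by simp
  finally show ?thesis by (simp only: P_def C_def)
qed

section \<open>Points of small norm\<close>

lemma sum_reciprocal_flat_le:
  assumes r: "0 < r"
  shows "(\<Sum>xs\<in>configs (4*r) h. 1 / (real N + 1 + (\<Sum>i<h. of_bool (xs ! i \<in> flat r))))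
    \<le> real (4*r) ^ h * (1 / (real N + 1 + real h / 4))"
proof (induction h arbitrary: N)
  case (Suc h)
  define m where "m = 4 * r"
  define f where "f xs = (\<Sum>i<h. of_bool (xs ! i \<in> flat r) :: real)" for xs
  define T where "T N = (\<Sum>xs\<in>configs m h. 1 / (real N + 1 + f xs))" for N
  have IH: "T N \<le> real m ^ h * (1 / (real N + 1 + real h / 4))" for N
    unfolding T_def m_def f_def by (rule Suc.IH)
  have "(\<Sum>xs\<in>configs m (Suc h). 1 / (real N + 1 + (\<Sum>i<Suc h. of_bool (xs ! i \<in> flat r))))
      = (\<Sum>a<m. T (if a \<in> flat r then Suc N else N))"
    unfolding sum_configs_Suc sum_nth_Cons[where f = "\<lambda>x. of_bool (x \<in> flat r)"] T_def f_def[symmetric]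
    by (intro sum.cong refl) (auto simp: algebra_simps)
  also have "\<dots> = (\<Sum>a\<in>flat r. T (Suc N)) + (\<Sum>a\<in>{..<m} - flat r. T N)"
    using flat_subset[of r] unfolding if_distrib[of T] m_def
    by (simp add: sum.If_cases Int_absorb1 Diff_eq)
  also have "\<dots> = 2 * real r * T (Suc N) + 2 * real r * T N"
    using flat_subset[of r] by (simp add: card_flat card_Diff_subset m_def algebra_simps)
  also have "\<dots> \<le> 2 * real r * (real m ^ h * (1 / (real (Suc N) + 1 + real h / 4)))
      + 2 * real r * (real m ^ h * (1 / (real N + 1 + real h / 4)))"
    by (intro add_mono mult_left_mono IH) auto
  \<comment> \<open>The mixing weight is \<open>p = 1/2\<close>, the share of flat indices, so each
    coordinate adds 1/4 to the denominator.\<close>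
  also have "\<dots> = real m ^ Suc h * ((1 - 1 / 2) / (real N + 1 + real h / 4)
      + (1 / 2) / (real N + 1 + real h / 4 + 1))"
    by (simp add: m_def field_simps)
  also have "\<dots> \<le> real m ^ Suc h * (1 / (real N + 1 + real h / 4 + 1 / 2 / 2))"
    by (intro mult_left_mono reciprocal_mixture_le) auto
  also have "real N + 1 + real h / 4 + 1 / 2 / 2 = real N + 1 + real (Suc h) / 4" by (simp add: field_simps)
  finally show ?case by (simp only: m_def)
qed simp

text \<open>The number of flat coordinates bounds the squared norm from below. Markov's inequality
  for the reciprocal of one plus this number then suffices; no exponential tail is required since a
  density of order \<open>l / h\<close> is small enough.\<close>

lemma card_low_norm_le:
  assumes r: "0 < r" and l: "0 \<le> l" and h: "0 < h"
  shows "real (card {xs \<in> configs (4*r) h. dot r h xs xs \<le> l}) \<le> real (4*r) ^ h * (4 * (l + 1) / real h)"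
proof -
  define C where "C = configs (4*r) h"
  define f where "f xs = (\<Sum>i<h. of_bool (xs ! i \<in> flat r) :: real)" for xs
  have f0: "0 \<le> f xs" for xs by (auto simp: f_def intro: sum_nonneg)
  have f: "f xs \<le> dot r h xs xs" for xs
    unfolding f_def dot_def
  proof (intro sum_mono)
    fix i
    show "of_bool (xs ! i \<in> flat r) \<le> coord r (xs ! i) * coord r (xs ! i)"
      using r by (auto simp: flat_def coord_left coord_right)
  qed
  have "real (card {xs \<in> C. dot r h xs xs \<le> l}) / (l + 1) = (\<Sum>xs\<in>{xs \<in> C. dot r h xs xs \<le> l}. 1 / (l + 1))"
    by simp
  also have "\<dots> \<le> (\<Sum>xs\<in>{xs \<in> C. dot r h xs xs \<le> l}. 1 / (real 0 + 1 + f xs))"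
  proof (intro sum_mono divide_left_mono)
    fix xs assume "xs \<in> {xs \<in> C. dot r h xs xs \<le> l}"
    then show "real 0 + 1 + f xs \<le> l + 1" using f[of xs] by simp
    show "0 < (l + 1) * (real 0 + 1 + f xs)" using l f0[of xs] by simp
  qed simp
  also have "\<dots> \<le> (\<Sum>xs\<in>C. 1 / (real 0 + 1 + f xs))"
    using f0 by (intro sum_mono2) (auto simp: C_def)
  also have "\<dots> \<le> real (4*r) ^ h * (1 / (real 0 + 1 + real h / 4))"
    unfolding C_def f_def by (rule sum_reciprocal_flat_le[OF r])
  also have "\<dots> \<le> real (4*r) ^ h * (4 / real h)"
    using h by (intro mult_left_mono) (auto simp: field_simps)
  finally have "real (card {xs \<in> C. dot r h xs xs \<le> l}) \<le> real (4*r) ^ h * (4 / real h) * (l + 1)"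
    using l by (simp only: pos_divide_le_eq)
  then show ?thesis by (simp only: C_def times_divide_eq_right times_divide_eq_left mult.assoc)
qed

section \<open>Nearly antipodal pairs\<close>

text \<open>The two norm conditions delete the inner edges at points near the origin, which would
  otherwise create loops and triangles.\<close>

definition near_antipodal :: "nat \<Rightarrow> nat \<Rightarrow> real \<Rightarrow> nat list \<Rightarrow> nat list \<Rightarrow> bool" where
  "near_antipodal r h s xs ys \<longleftrightarrow>
    (\<Sum>i<h. (coord r (xs ! i) + coord r (ys ! i))\<^sup>2) \<le> s \<and> 3 * s < dot r h xs xs \<and> 3 * s < dot r h ys ys"

lemma near_antipodal_sym: "near_antipodal r h s xs ys \<Longrightarrow> near_antipodal r h s ys xs"
  by (simp add: near_antipodal_def add.commute)

lemma not_near_antipodal_self: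
  assumes "0 \<le> s"
  shows "\<not> near_antipodal r h s xs xs"
proof
  assume *: "near_antipodal r h s xs xs"
  have "(\<Sum>i<h. (coord r (xs ! i) + coord r (xs ! i))\<^sup>2) = 4 * dot r h xs xs"
    by (simp add: dot_def sum_distrib_left power2_eq_square)
  then show False using * assms by (simp add: near_antipodal_def)
qed

text \<open>Since \<open>2a = (a + b) + (a + c) - (b + c)\<close>, Cauchy-Schwarz gives
  \<open>4 |a|^2 \<le> 9 s\<close>, against \<open>|a|^2 > 3 s\<close>.\<close>

lemma near_antipodal_triangle_free:
  assumes s: "0 \<le> s" and ab: "near_antipodal r h s a b" and bc: "near_antipodal r h s b c"
    and ac: "near_antipodal r h s a c"
  shows False
proof -
  have "4 * (x * x) \<le> 3 * (x + y)\<^sup>2 + 3 * (x + z)\<^sup>2 + 3 * (y + z)\<^sup>2" for x y z :: real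
  proof -
    have "3 * (x + y)\<^sup>2 + 3 * (x + z)\<^sup>2 + 3 * (y + z)\<^sup>2 - 4 * (x * x)
        = ((x + y) - (x + z))\<^sup>2 + ((x + y) + (y + z))\<^sup>2 + ((x + z) + (y + z))\<^sup>2"
      by (simp add: power2_eq_square algebra_simps)
    then show ?thesis by (smt (verit) zero_le_power2)
  qed
  then have "4 * dot r h a a \<le> (\<Sum>i<h. 3 * (coord r (a ! i) + coord r (b ! i))\<^sup>2
      + 3 * (coord r (a ! i) + coord r (c ! i))\<^sup>2 + 3 * (coord r (b ! i) + coord r (c ! i))\<^sup>2)"
    unfolding dot_def sum_distrib_left by (intro sum_mono)
  also have "\<dots> \<le> 3 * s + 3 * s + 3 * s"
    using ab bc ac unfolding sum.distrib sum_distrib_left[symmetric] near_antipodal_def by simp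
  finally show False using ab s by (simp add: near_antipodal_def)
qed

text \<open>The four inner products add up to \<open><a + b, c + d>\<close>, which is at most half
  of \<open>|a + b|^2 + |c + d|^2\<close>, hence at most \<open>s\<close>.\<close>

lemma near_antipodal_cross_free:
  assumes ab: "near_antipodal r h s a b" and cd: "near_antipodal r h s c d"
    and "s / 4 < dot r h a c" "s / 4 < dot r h a d" "s / 4 < dot r h b c" "s / 4 < dot r h b d"
  shows False
proof -
  have "2 * ((x + y) * (z + w)) \<le> (x + y)\<^sup>2 + (z + w)\<^sup>2" for x y z w :: real
    using sum_squares_bound[of "x + y" "z + w"] by (simp only: mult.assoc)
  then have "(\<Sum>i<h. 2 * ((coord r (a ! i) + coord r (b ! i)) * (coord r (c ! i) + coord r (d ! i))))
      \<le> (\<Sum>i<h. (coord r (a ! i) + coord r (b ! i))\<^sup>2 + (coord r (c ! i) + coord r (d ! i))\<^sup>2)"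
    by (intro sum_mono)
  also have "\<dots> \<le> s + s"
    using ab cd unfolding sum.distrib near_antipodal_def by simp
  also have "(\<Sum>i<h. 2 * ((coord r (a ! i) + coord r (b ! i)) * (coord r (c ! i) + coord r (d ! i))))
      = 2 * (dot r h a c + dot r h a d + dot r h b c + dot r h b d)"
    by (simp add: dot_def sum_distrib_left sum.distrib algebra_simps)
  finally have "dot r h a c + dot r h a d + dot r h b c + dot r h b d \<le> s" by simp
  moreover have "s < 4 * dot r h a c" "s < 4 * dot r h a d" "s < 4 * dot r h b c" "s < 4 * dot r h b d"
    using assms(3-) by auto
  ultimately show False by linarith
qed

text \<open>\<open>coord\<close> has Lipschitz constant \<open>1/r\<close>, and
  \<open>k^2/2 - 1 \<le> (k - 1)^2\<close> absorbs the shift in \<open>cost\<close> at the price of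
  a loss \<open>1/(4r)^2\<close> per coordinate.\<close>

lemma cost_ge:
  "((coord r x - coord r y)\<^sup>2 / 32 - 1 / (real (4*r))\<^sup>2) / 5 \<le> cost (4*r) x y"
proof -
  define k where "k = \<bar>real x - real y\<bar>"
  have "(coord r x - coord r y)\<^sup>2 \<le> (k / real r)\<^sup>2"
    using power_mono[OF coord_lipschitz[of r x y], of 2] by (simp add: k_def)
  also have "\<dots> = 16 * (k / real (4*r))\<^sup>2"
    by (simp add: power_divide power_mult_distrib)
  finally have "(coord r x - coord r y)\<^sup>2 / 32 \<le> (k\<^sup>2 / 2) / (real (4*r))\<^sup>2"
    by (simp add: power_divide)
  then have "(coord r x - coord r y)\<^sup>2 / 32 - 1 / (real (4*r))\<^sup>2 \<le> (k\<^sup>2 / 2 - 1) / (real (4*r))\<^sup>2"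
    by (simp add: diff_divide_distrib)
  also have "\<dots> \<le> (max 0 (k - 1))\<^sup>2 / (real (4*r))\<^sup>2"
  proof (rule divide_right_mono)
    show "k\<^sup>2 / 2 - 1 \<le> (max 0 (k - 1))\<^sup>2"
    proof (cases "1 \<le> k")
      case True
      have "(k - 1)\<^sup>2 - (k\<^sup>2 / 2 - 1) = (k - 2)\<^sup>2 / 2" by (simp add: power2_eq_square field_simps)
      then have "k\<^sup>2 / 2 - 1 \<le> (k - 1)\<^sup>2" by (smt (verit) zero_le_power2 divide_nonneg_nonneg)
      then show ?thesis using True by (simp add: max_def)
    next
      case False
      then have "k\<^sup>2 \<le> 1" by (simp add: k_def power_le_one)
      then show ?thesis using False by (simp add: max_def)
    qed
  qed simp
  finally show ?thesis by (simp add: cost_def k_def power_divide)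
qed

text \<open>After points of small norm are discarded, the remainder \<open>H\<close> is far from its
  own reflection, because \<open>|x + y|\<close> is the distance from \<open>x\<close> to the
  antipode of \<open>y\<close>. Concentration for these two sets of equal size bounds
  \<open>(card H)^2\<close>, which halves the exponent.\<close>

lemma near_antipodal_free_card_le:
  assumes r: "0 < r" and h: "0 < h" "h \<le> (4 * r)\<^sup>2" and s: "32 \<le> s"
    and A: "A \<subseteq> configs (4*r) h"
    and free: "\<And>xs ys. xs \<in> A \<Longrightarrow> ys \<in> A \<Longrightarrow> \<not> near_antipodal r h s xs ys"
  shows "real (card A) \<le> real (4*r) ^ h * (4 * (3 * s + 1) / real h + exp (- (s / 32 - 1) / 10))"
proof -
  define H where "H = {xs \<in> A. 3 * s < dot r h xs xs}"
  define L where "L = {xs \<in> configs (4*r) h. dot r h xs xs \<le> 3 * s}"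
  define t where "t = (s / 32 - 1) / 5"
  have H: "H \<subseteq> configs (4*r) h" using A by (auto simp: H_def)
  have sep: "t \<le> (\<Sum>i<h. cost (4*r) (xs ! i) (zs ! i))" if xs: "xs \<in> H" and zs: "zs \<in> reflect r ` H" for xs zs
  proof -
    obtain ys where ys: "ys \<in> H" "zs = reflect r ys" using zs by auto
    have "s < (\<Sum>i<h. (coord r (xs ! i) + coord r (ys ! i))\<^sup>2)"
      using free[of xs ys] xs ys(1) by (auto simp: H_def near_antipodal_def)
    also have "\<dots> = (\<Sum>i<h. (coord r (xs ! i) - coord r (zs ! i))\<^sup>2)"
      using H ys by (intro sum.cong) (auto simp: coord_reflect_nth)
    finally have "s < (\<Sum>i<h. (coord r (xs ! i) - coord r (zs ! i))\<^sup>2)" .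
    \<comment> \<open>The condition \<open>h \<le> (4r)^2\<close> keeps the rounding loss of all
      coordinates together below 1.\<close>
    moreover have "real h * (1 / (real (4*r))\<^sup>2) \<le> 1"
    proof -
      have "real h \<le> (real (4*r))\<^sup>2" using h(2) by (metis of_nat_le_iff of_nat_power)
      then show ?thesis using r by (simp add: divide_le_eq)
    qed
    ultimately have "t \<le> ((\<Sum>i<h. (coord r (xs ! i) - coord r (zs ! i))\<^sup>2) / 32 - real h * (1 / (real (4*r))\<^sup>2)) / 5"
      unfolding t_def by (intro divide_right_mono) auto
    also have "\<dots> = (\<Sum>i<h. ((coord r (xs ! i) - coord r (zs ! i))\<^sup>2 / 32 - 1 / (real (4*r))\<^sup>2) / 5)"
      by (simp add: sum_subtractf sum_divide_distrib[symmetric])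
    also have "\<dots> \<le> (\<Sum>i<h. cost (4*r) (xs ! i) (zs ! i))"
      by (intro sum_mono cost_ge)
    finally show ?thesis .
  qed
  have "real (card H) * real (card (reflect r ` H)) \<le> (real (4*r) ^ h)\<^sup>2 * exp (- t)"
    by (rule separated_configs_card) (use r s H sep in \<open>auto simp: t_def intro: reflect_in_configs\<close>)
  moreover have "card (reflect r ` H) = card H"
    by (intro card_image inj_on_subset[OF inj_on_reflect H])
  moreover have "exp (- t) = (exp (- t / 2))\<^sup>2" by (simp add: power2_eq_square flip: exp_add)
  ultimately have "(real (card H))\<^sup>2 \<le> (real (4*r) ^ h * exp (- t / 2))\<^sup>2"
    by (simp only: power_mult_distrib power2_eq_square[of "real (card H)"])
  then have cH: "real (card H) \<le> real (4*r) ^ h * exp (- t / 2)"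
    by (rule power2_le_imp_le) simp
  have cL: "real (card L) \<le> real (4*r) ^ h * (4 * (3 * s + 1) / real h)"
    unfolding L_def using r s h by (intro card_low_norm_le) auto
  have "A \<subseteq> L \<union> H" using A by (auto simp: H_def L_def)
  then have "card A \<le> card (L \<union> H)"
    using finite_subset[OF H] by (intro card_mono) (auto simp: L_def)
  then have "real (card A) \<le> real (card L) + real (card H)"
    using card_Un_le[of L H] by linarith
  also have "\<dots> \<le> real (4*r) ^ h * (4 * (3 * s + 1) / real h) + real (4*r) ^ h * exp (- t / 2)"
    using cH cL by linarith
  also have "- t / 2 = - (s / 32 - 1) / 10" by (simp add: t_def field_simps)
  finally show ?thesis by (simp only: distrib_left)
qed

section \<open>Blow-up with an additional independent set\<close>

lemma independence_number_le:
  assumes "finite V" and "\<And>S. S \<subseteq> V \<Longrightarrow> indep S E \<Longrightarrow> card S \<le> b"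
  shows "independence_number V E \<le> b"
  unfolding independence_number_def
proof (rule Max.boundedI)
  show "finite (card ` {S. S \<subseteq> V \<and> indep S E})"
    using assms(1) by simp
  have "indep {} E" by (simp add: indep_def)
  then show "card ` {S. S \<subseteq> V \<and> indep S E} \<noteq> {}" by blast
qed (use assms in auto)

text \<open>Vertices \<open>(0, c, _)\<close> and \<open>(1, c, _)\<close> are the copies of \<open>c\<close> in the two sides \<open>X\<close> and \<open>Y\<close>;
  vertices with first component 2 form the additional independent set.\<close>

definition blowup_adj :: "('a \<Rightarrow> 'a \<Rightarrow> bool) \<Rightarrow> ('a \<Rightarrow> 'a \<Rightarrow> bool) \<Rightarrow> nat \<times> 'a \<times> nat \<Rightarrow> nat \<times> 'a \<times> nat \<Rightarrow> bool"
  where "blowup_adj near cross = (\<lambda>(i, c, _) (j, d, _).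
    i = j \<and> i < 2 \<and> near c d \<or> i = 0 \<and> j = 1 \<and> cross c d \<or> i = 1 \<and> j = 0 \<and> cross d c
    \<or> i = 0 \<and> j = 2 \<or> i = 2 \<and> j = 0)"

text \<open>A vertex of class 2 has neighbours only in \<open>X\<close>, so the other three would
  form a triangle there. Otherwise either three vertices share a side, a triangle again, or the
  split is two and two, excluded by \<open>cr\<close>.\<close>

lemma blowup_K4_free:
  assumes sym: "\<And>a b. near a b \<Longrightarrow> near b a"
    and tri: "\<And>a b c. near a b \<Longrightarrow> near b c \<Longrightarrow> near a c \<Longrightarrow> False"
    and cr: "\<And>a b c d. near a b \<Longrightarrow> near c d \<Longrightarrow> cross a c \<Longrightarrow> cross a d \<Longrightarrow> cross b c \<Longrightarrow> cross b d \<Longrightarrow> False"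
    and adj: "blowup_adj near cross u v" "blowup_adj near cross u w" "blowup_adj near cross u x"
      "blowup_adj near cross v w" "blowup_adj near cross v x" "blowup_adj near cross w x"
  shows False
proof -
  obtain a a1 a2 where u: "u = (a, a1, a2)" by (cases u)
  obtain b b1 b2 where v: "v = (b, b1, b2)" by (cases v)
  obtain c c1 c2 where w: "w = (c, c1, c2)" by (cases w)
  obtain d d1 d2 where x: "x = (d, d1, d2)" by (cases x)
  have ran: "a \<in> {0, 1, 2}" "b \<in> {0, 1, 2}" "c \<in> {0, 1, 2}" "d \<in> {0, 1, 2}"
    using adj by (auto simp: blowup_adj_def u v w x)
  \<comment> \<open>The six instances of \<open>cr\<close> are the six choices of the two vertices
    that lie in \<open>X\<close>.\<close>
  note facts = adj[unfolded u v w x] tri[of a1 b1 c1] tri[of a1 b1 d1] tri[of a1 c1 d1] tri[of b1 c1 d1]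
    cr[of a1 b1 c1 d1] cr[of c1 d1 a1 b1] cr[of a1 c1 b1 d1] cr[of b1 d1 a1 c1]
    cr[of a1 d1 b1 c1] cr[of b1 c1 a1 d1]
  show False
    using ran by (elim insertE emptyE; use facts in \<open>simp add: blowup_adj_def\<close>)
qed

text \<open>The edge count uses only edges leaving \<open>X\<close>, namely cross edges and edges to
  the extra class; inner edges serve the independence bound alone. An independent set projects on
  each side to a set free of \<open>near\<close> pairs, and each point has \<open>q\<close>
  copies.\<close>

lemma blowup_graph:
  fixes C :: "'a set" and near cross :: "'a \<Rightarrow> 'a \<Rightarrow> bool"
  assumes C: "finite C"
    and sym: "\<And>a b. near a b \<Longrightarrow> near b a"
    and irr: "\<And>a. \<not> near a a"
    and tri: "\<And>a b c. near a b \<Longrightarrow> near b c \<Longrightarrow> near a c \<Longrightarrow> False"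
    and cr: "\<And>a b c d. near a b \<Longrightarrow> near c d \<Longrightarrow> cross a c \<Longrightarrow> cross a d \<Longrightarrow> cross b c \<Longrightarrow> cross b d \<Longrightarrow> False"
    and free: "\<And>A. A \<subseteq> C \<Longrightarrow> (\<And>a b. a \<in> A \<Longrightarrow> b \<in> A \<Longrightarrow> \<not> near a b) \<Longrightarrow> card A \<le> \<alpha>"
  obtains E where "simple_graph {..<2 * (card C * q) + k} E"
    "complete_free 4 {..<2 * (card C * q) + k} E"
    "card C * q * k + card {(c, d) \<in> C \<times> C. cross c d} * q\<^sup>2 \<le> card E"
    "independence_number {..<2 * (card C * q) + k} E \<le> k + 2 * (\<alpha> * q)"
proof -
  define n where "n = 2 * (card C * q) + k"
  define z :: 'a where "z = undefined"
  define V where "V = {0::nat, 1} \<times> C \<times> {..<q} \<union> {2} \<times> {z} \<times> {..<k}"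
  have finV: "finite V" using C by (simp add: V_def)
  have "card V = card ({0::nat, 1} \<times> C \<times> {..<q}) + card ({2::nat} \<times> {z} \<times> {..<k})"
    unfolding V_def using C by (intro card_Un_disjoint) auto
  then have cardV: "card V = n" by (simp add: n_def card_cartesian_product)
  obtain f where f: "bij_betw f V {..<n}"
    using ex_bij_betw_finite_nat[OF finV] cardV by (auto simp: atLeast0LessThan)
  have inj: "inj_on f V" and ran: "f ` V = {..<n}" using f by (auto simp: bij_betw_def)
  let ?adj = "blowup_adj near cross"
  define E where "E = {{f x, f y} |x y. x \<in> V \<and> y \<in> V \<and> ?adj x y}"
  have adj_sym: "?adj x y \<Longrightarrow> ?adj y x" for x y
    by (auto simp: blowup_adj_def dest: sym)
  have adj_irr: "\<not> ?adj x x" for x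
    using irr by (auto simp: blowup_adj_def)
  have E_iff: "{f x, f y} \<in> E \<longleftrightarrow> ?adj x y" if "x \<in> V" "y \<in> V" for x y
  proof
    assume "{f x, f y} \<in> E"
    then obtain x' y' where xy: "x' \<in> V" "y' \<in> V" "?adj x' y'" "{f x, f y} = {f x', f y'}"
      by (auto simp: E_def)
    then have "f x = f x' \<and> f y = f y' \<or> f x = f y' \<and> f y = f x'"
      by (simp only: doubleton_eq_iff)
    then have "x = x' \<and> y = y' \<or> x = y' \<and> y = x'"
      using that xy(1,2) inj by (metis inj_on_eq_iff)
    then show "?adj x y" using xy(3) adj_sym by blast
  next
    assume "?adj x y"
    then show "{f x, f y} \<in> E" using that unfolding E_def by blast
  qed
  have simple: "simple_graph {..<n} E"
    unfolding simple_graph_def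
  proof (intro conjI subsetI)
    fix e assume "e \<in> E"
    then obtain x y where xy: "x \<in> V" "y \<in> V" "?adj x y" "e = {f x, f y}" by (auto simp: E_def)
    then have "f x \<noteq> f y" using inj adj_irr by (metis inj_on_eq_iff)
    then show "e \<in> [{..<n}]\<^bsup>2\<^esup>" using xy ran by (auto simp: nsets_def)
  qed simp
  have K4: "complete_free 4 {..<n} E"
    unfolding complete_free_def
  proof
    assume "\<exists>K\<in>[{..<n}]\<^bsup>4\<^esup>. clique K E"
    then obtain a b c d where abcd: "a \<in> {..<n}" "b \<in> {..<n} - {a}" "c \<in> {..<n} - {a, b}"
        "d \<in> {..<n} - {a, b, c}" and K: "clique {a, b, c, d} E"
      unfolding nsets_4_eq by blast
    have im: "a \<in> {..<n} \<Longrightarrow> \<exists>x\<in>V. a = f x" for a by (auto simp flip: ran)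
    obtain x where x: "x \<in> V" "a = f x" using im abcd(1) by blast
    obtain y where y: "y \<in> V" "b = f y" using im abcd(2) by blast
    obtain v where v: "v \<in> V" "c = f v" using im abcd(3) by blast
    obtain w where w: "w \<in> V" "d = f w" using im abcd(4) by blast
    have "{a, b} \<in> E" "{a, c} \<in> E" "{a, d} \<in> E" "{b, c} \<in> E" "{b, d} \<in> E" "{c, d} \<in> E"
      using K abcd by (auto simp: clique_def)
    then have "?adj x y" "?adj x v" "?adj x w" "?adj y v" "?adj y w" "?adj v w"
      unfolding x(2) y(2) v(2) w(2) using E_iff x(1) y(1) v(1) w(1) by simp_all
    then show False using blowup_K4_free[of near cross x y v w] sym tri cr by blast
  qed
  have edges: "card C * q * k + card {(c, d) \<in> C \<times> C. cross c d} * q\<^sup>2 \<le> card E"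
  proof -
    define P where "P = {(c, d) \<in> C \<times> C. cross c d}"
    have finP: "finite P" using C by (auto intro: finite_subset[of _ "C \<times> C"] simp: P_def)
    \<comment> \<open>Edges are counted as ordered pairs starting in \<open>X\<close> and ending
      outside it; this orientation makes the passage to two-element sets injective.\<close>
    define D1 where "D1 = (\<lambda>((c, i), l). ((0::nat, c, i), (2::nat, z, l))) ` ((C \<times> {..<q}) \<times> {..<k})"
    define D2 where "D2 = (\<lambda>((c, d), (i, l)). ((0::nat, c, i), (1::nat, d, l))) ` (P \<times> ({..<q} \<times> {..<q}))"
    have "card D1 = card C * q * k"
      unfolding D1_def by (subst card_image) (auto simp: inj_on_def card_cartesian_product)
    moreover have "card D2 = card P * q\<^sup>2"
      unfolding D2_def by (subst card_image) (auto simp: inj_on_def card_cartesian_product power2_eq_square)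
    moreover have "card (D1 \<union> D2) = card D1 + card D2"
      using C finP by (intro card_Un_disjoint) (auto simp: D1_def D2_def)
    moreover have "card (D1 \<union> D2) \<le> card E"
    proof (rule card_inj_on_le[where f = "\<lambda>(x, y). {f x, f y}"])
      have DV: "x \<in> V \<and> y \<in> V \<and> fst x = 0 \<and> fst y \<noteq> 0 \<and> ?adj x y" if "(x, y) \<in> D1 \<union> D2" for x y
        using that by (auto simp: D1_def D2_def V_def P_def blowup_adj_def)
      show "inj_on (\<lambda>(x, y). {f x, f y}) (D1 \<union> D2)"
      proof (rule inj_onI, clarify)
        fix x y x' y' assume D: "(x, y) \<in> D1 \<union> D2" "(x', y') \<in> D1 \<union> D2" and e: "{f x, f y} = {f x', f y'}"
        have V4: "x \<in> V" "y \<in> V" "x' \<in> V" "y' \<in> V" and t: "fst x = 0" "fst y' \<noteq> 0"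
          using DV[OF D(1)] DV[OF D(2)] by auto
        have "f x = f x' \<and> f y = f y' \<or> f x = f y' \<and> f y = f x'"
          using e by (simp only: doubleton_eq_iff)
        then have "x = x' \<and> y = y' \<or> x = y' \<and> y = x'"
          using V4 inj by (metis inj_on_eq_iff)
        then show "x = x' \<and> y = y'" using t by auto
      qed
      show "(\<lambda>(x, y). {f x, f y}) ` (D1 \<union> D2) \<subseteq> E"
        using DV by (fastforce simp: E_def)
      show "finite E"
        using simple by (auto simp: simple_graph_def intro: finite_subset[OF _ finite_imp_finite_nsets])
    qed
    ultimately show ?thesis by (simp add: P_def)
  qed
  have ind: "independence_number {..<n} E \<le> k + 2 * (\<alpha> * q)"
  proof (rule independence_number_le)
    fix S assume S: "S \<subseteq> {..<n}" and indS: "indep S E"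
    define T where "T = {x \<in> V. f x \<in> S}"
    have finT: "finite T" using finV by (simp add: T_def)
    have "S = f ` T" using S ran by (auto simp: T_def)
    then have cardS: "card S \<le> card T" using card_image_le[OF finT, of f] by simp
    have nadj: "\<not> ?adj x y" if "x \<in> T" "y \<in> T" for x y
    proof
      assume a: "?adj x y"
      then have "f x \<noteq> f y" using that inj adj_irr by (metis (mono_tags, lifting) T_def inj_on_eq_iff mem_Collect_eq)
      then show False using indS that E_iff[of x y] a by (auto simp: T_def indep_def)
    qed
    define A where "A i = {c \<in> C. \<exists>l. (i, c, l) \<in> T}" for i :: nat
    have A: "card (A i) \<le> \<alpha>" if "i < 2" for i
    proof (rule free)
      fix c d assume "c \<in> A i" "d \<in> A i"
      then obtain l l' where "(i, c, l) \<in> T" "(i, d, l') \<in> T" by (auto simp: A_def)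
      then show "\<not> near c d" using nadj[of "(i, c, l)" "(i, d, l')"] that by (auto simp: blowup_adj_def)
    qed (auto simp: A_def)
    have finA: "finite (A i)" for i using C by (simp add: A_def)
    have "T \<subseteq> ({0} \<times> A 0 \<times> {..<q} \<union> {1} \<times> A 1 \<times> {..<q}) \<union> {2} \<times> {z} \<times> {..<k}"
      by (auto simp: T_def V_def A_def)
    then have "card T \<le> card (({0} \<times> A 0 \<times> {..<q} \<union> {1} \<times> A 1 \<times> {..<q}) \<union> {2::nat} \<times> {z} \<times> {..<k})"
      by (rule card_mono[rotated]) (use finA in auto)
    also have "\<dots> \<le> card ({0::nat} \<times> A 0 \<times> {..<q}) + card ({1::nat} \<times> A 1 \<times> {..<q}) + card ({2::nat} \<times> {z} \<times> {..<k})"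
      by (meson add_right_mono card_Un_le order_trans)
    also have "\<dots> = card (A 0) * q + card (A 1) * q + k"
      by (simp add: card_cartesian_product)
    also have "\<dots> \<le> \<alpha> * q + \<alpha> * q + k"
      using A[of 0] A[of 1] by (intro add_mono mult_right_mono) auto
    finally show "card S \<le> k + 2 * (\<alpha> * q)" using cardS by simp
  qed simp
  show thesis
    using that simple K4 edges ind unfolding n_def by blast
qed

section \<open>Choice of parameters\<close>

text \<open>With \<open>r = h\<close> the cross density is at least
  \<open>1/2 - 62 \<delta>\<close>, and an extra class of about \<open>124 \<delta> n\<close>
  vertices restores \<open>n^2/8\<close> edges. The hypothesis \<open>big\<close> bounds the
  rounding in the blow-up by \<open>\<delta> n\<close>.\<close>

lemma graph_at_scale:
  fixes h n :: nat
  defines "\<delta> \<equiv> ln (real h) / sqrt (real h)"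
  assumes lnh: "1 \<le> ln (real h)" and small: "496 * \<delta> \<le> 1"
    and big: "2 * real (4 * h) ^ h \<le> \<delta> * real n"
  obtains E where "simple_graph {..<n} E" "complete_free 4 {..<n} E" "real n ^ 2 / 8 \<le> real (card E)"
    "real (independence_number {..<n} E) \<le> 2051 * \<delta> * real n"
proof -
  have h: "1 \<le> real h" using lnh by (cases h) auto
  then have h0: "0 < h" by simp
  have sq: "0 < sqrt (real h)" "sqrt (real h) \<le> real h" using h by (auto intro!: real_le_lsqrt self_le_power)
  have \<delta>: "0 < \<delta>" "1 / sqrt (real h) \<le> \<delta>"
    unfolding \<delta>_def using lnh sq
    by (meson divide_pos_pos less_le_trans zero_less_one) (use lnh in \<open>auto intro: divide_right_mono\<close>)
  \<comment> \<open>The factor 160 turns the concentration exponent \<open>- (s/32 - 1)/10\<close>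
    into \<open>1/10 - (ln h)/2\<close>, so that term is of order \<open>1 / sqrt h\<close>.\<close>
  define s where "s = 160 * ln (real h)"
  define C where "C = configs (4 * h) h"
  define N where "N = card C"
  have N: "real N = real (4 * h) ^ h" by (simp add: N_def C_def card_configs)
  have N0: "0 < N" using N h0 by (metis of_nat_0_less_iff zero_less_power mult_pos_pos zero_less_numeral)
  \<comment> \<open>1926 is 1924 for points of small norm, from
    \<open>4 (3 s + 1) \<le> 1924 ln h\<close>, plus 2 for the concentration term.\<close>
  define \<alpha> where "\<alpha> = nat \<lfloor>1926 * \<delta> * real N\<rfloor>"
  have \<alpha>: "real \<alpha> \<le> 1926 * \<delta> * real N"
    unfolding \<alpha>_def using \<delta> by (intro of_nat_floor) auto
  have free: "card A \<le> \<alpha>"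
    if "A \<subseteq> C" "\<And>a b. a \<in> A \<Longrightarrow> b \<in> A \<Longrightarrow> \<not> near_antipodal h h s a b" for A
  proof -
    have "h \<le> (4 * h)\<^sup>2" by (simp add: power2_eq_square)
    then have "real (card A) \<le> real N * (4 * (3 * s + 1) / real h + exp (- (s / 32 - 1) / 10))"
      unfolding N using that lnh h0 by (intro near_antipodal_free_card_le) (auto simp: s_def C_def)
    also have "\<dots> \<le> real N * (1924 * \<delta> + 2 * \<delta>)"
    proof (intro mult_left_mono add_mono)
      have "4 * (3 * s + 1) / real h \<le> 1924 * ln (real h) / real h"
        using lnh by (intro divide_right_mono) (auto simp: s_def)
      also have "\<dots> \<le> 1924 * ln (real h) / sqrt (real h)"
        using sq lnh h by (intro divide_left_mono) auto
      finally show "4 * (3 * s + 1) / real h \<le> 1924 * \<delta>" by (simp add: \<delta>_def)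
      have "- (s / 32 - 1) / 10 = 1 / 10 - ln (sqrt (real h))"
        using h by (simp add: s_def ln_sqrt)
      then have "exp (- (s / 32 - 1) / 10) = exp (1 / 10) / sqrt (real h)"
        using sq by (simp only: exp_diff exp_ln)
      also have "\<dots> \<le> 2 / sqrt (real h)"
      proof (rule divide_right_mono)
        have "exp (1 / 10) \<le> (1::real) + 1 / 10 + (1 / 10)\<^sup>2" by (rule exp_bound) auto
        then show "exp (1 / 10) \<le> (2::real)" by (simp add: power2_eq_square)
      qed (use sq in simp)
      also have "\<dots> \<le> 2 * \<delta>" using \<delta>(2) by simp
      finally show "exp (- (s / 32 - 1) / 10) \<le> 2 * \<delta>" .
    qed simp
    finally have "real (card A) \<le> 1926 * \<delta> * real N" by (simp add: algebra_simps)
    then show ?thesis unfolding \<alpha>_def by (simp add: le_nat_floor)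
  qed
  define P where "P = card {(c, d) \<in> C \<times> C. s / 4 < dot h h c d}"
  have P: "(real N)\<^sup>2 * (1 / 2 - 62 * \<delta>) \<le> real P"
  proof -
    have "3 / 2 * (s / 4 + 1) / sqrt (real h) \<le> 62 * ln (real h) / sqrt (real h)"
      using lnh sq by (intro divide_right_mono) (auto simp: s_def)
    then have "(real N)\<^sup>2 * (1 / 2 - 62 * \<delta>) \<le> (real N)\<^sup>2 * (1 / 2 - 3 / 2 * (s / 4 + 1) / sqrt (real h))"
      by (intro mult_left_mono) (auto simp: \<delta>_def)
    also have "\<dots> \<le> real P"
      unfolding P_def C_def N using lnh h0 by (intro card_dot_greater_ge) (auto simp: s_def)
    finally show ?thesis .
  qed
  \<comment> \<open>Aiming at \<open>2 N q = n - 124 \<delta> n\<close>, the floor loses at most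
    \<open>2 N \<le> \<delta> n\<close>; so \<open>k\<close> lies between
    \<open>124 \<delta> n\<close> and \<open>125 \<delta> n\<close>.\<close>
  define q where "q = nat \<lfloor>(real n - 124 * \<delta> * real n) / (2 * real N)\<rfloor>"
  define M where "M = N * q"
  have \<delta>n: "124 * \<delta> * real n \<le> real n / 4" using mult_right_mono[OF small, of "real n"] by simp
  have N2: "0 < 2 * real N" using N0 by simp
  have "real q \<le> (real n - 124 * \<delta> * real n) / (2 * real N)"
    unfolding q_def using \<delta>n by (intro of_nat_floor divide_nonneg_nonneg) auto
  then have "real q * (2 * real N) \<le> real n - 124 * \<delta> * real n"
    by (rule pos_le_divide_eq[OF N2, THEN iffD1])
  then have M_le: "2 * real M \<le> real n - 124 * \<delta> * real n" by (simp add: M_def algebra_simps)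
  have "(real n - 124 * \<delta> * real n) / (2 * real N) \<le> real q + 1"
    unfolding q_def by linarith
  then have "real n - 124 * \<delta> * real n \<le> (real q + 1) * (2 * real N)"
    by (rule pos_divide_le_eq[OF N2, THEN iffD1])
  then have M_ge: "real n - 124 * \<delta> * real n \<le> 2 * real M + 2 * real N" by (simp add: M_def algebra_simps)
  have "0 \<le> 124 * \<delta> * real n" using \<delta> by simp
  then have "2 * M \<le> n" using M_le by linarith
  define k where "k = n - 2 * M"
  have n: "n = 2 * (N * q) + k" using \<open>2 * M \<le> n\<close> by (simp add: k_def M_def)
  have k: "real k = real n - 2 * real M" using \<open>2 * M \<le> n\<close> by (simp add: k_def)
  have k_ge: "124 * \<delta> * real n \<le> real k" using M_le k by simp
  have k_le: "real k \<le> 125 * \<delta> * real n" using M_ge big k N by (simp add: algebra_simps)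
  obtain E where E: "simple_graph {..<n} E" "complete_free 4 {..<n} E" "N * q * k + P * q\<^sup>2 \<le> card E"
      "independence_number {..<n} E \<le> k + 2 * (\<alpha> * q)"
  proof (rule blowup_graph[of C "near_antipodal h h s" "\<lambda>c d. s / 4 < dot h h c d" \<alpha> q k,
        folded N_def P_def, folded n])
    show "finite C" by (simp add: C_def)
    have "0 \<le> s" using lnh by (simp add: s_def)
    then show "\<not> near_antipodal h h s a a" for a by (rule not_near_antipodal_self)
    show "near_antipodal h h s a b \<Longrightarrow> near_antipodal h h s b c \<Longrightarrow> near_antipodal h h s a c \<Longrightarrow> False"
      for a b c using \<open>0 \<le> s\<close> by (rule near_antipodal_triangle_free)
    show "near_antipodal h h s a b \<Longrightarrow> near_antipodal h h s b a" for a b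
      by (rule near_antipodal_sym)
    show "near_antipodal h h s a b \<Longrightarrow> near_antipodal h h s c d \<Longrightarrow> s / 4 < dot h h a c \<Longrightarrow>
        s / 4 < dot h h a d \<Longrightarrow> s / 4 < dot h h b c \<Longrightarrow> s / 4 < dot h h b d \<Longrightarrow> False" for a b c d
      by (rule near_antipodal_cross_free)
    show "A \<subseteq> C \<Longrightarrow> (\<And>a b. a \<in> A \<Longrightarrow> b \<in> A \<Longrightarrow> \<not> near_antipodal h h s a b) \<Longrightarrow> card A \<le> \<alpha>" for A
      by (rule free)
  qed (rule that)
  have "real n ^ 2 / 8 \<le> real (card E)"
  proof -
    have "real k \<le> 2 * real M"
    proof -
      have "125 * \<delta> * real n \<le> real n / 2" using \<delta>n \<delta> by simp
      then show ?thesis using k_le k by linarith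
    qed
    then have "real k * real k \<le> 2 * real M * real k" by (intro mult_right_mono) auto
    moreover have "248 * \<delta> * real M * real M \<le> real k * real M"
    proof (intro mult_right_mono)
      have "248 * \<delta> * real M = 124 * \<delta> * (2 * real M)" by simp
      also have "\<dots> \<le> 124 * \<delta> * real n" using \<open>2 * M \<le> n\<close> \<delta> by (intro mult_left_mono) auto
      finally show "248 * \<delta> * real M \<le> real k" using k_ge by simp
    qed simp
    \<comment> \<open>The surplus over \<open>n^2/8\<close> splits into two nonnegative parts, one
      by \<open>k \<le> 2 M\<close> and one by \<open>k \<ge> 248 \<delta> M\<close>.\<close>
    moreover have "real M * real k + (real M)\<^sup>2 * (1 / 2 - 62 * \<delta>) - (2 * real M + real k)\<^sup>2 / 8
        = (2 * real M * real k - real k * real k) / 8 + (real k * real M - 248 * \<delta> * real M * real M) / 4"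
      by (simp add: power2_eq_square field_simps)
    ultimately have "(2 * real M + real k)\<^sup>2 / 8 \<le> real M * real k + (real M)\<^sup>2 * (1 / 2 - 62 * \<delta>)"
      by (smt (verit) divide_nonneg_nonneg)
    also have "(real M)\<^sup>2 * (1 / 2 - 62 * \<delta>) = (real q)\<^sup>2 * ((real N)\<^sup>2 * (1 / 2 - 62 * \<delta>))"
      by (simp add: M_def power_mult_distrib)
    also have "real M * real k + (real q)\<^sup>2 * ((real N)\<^sup>2 * (1 / 2 - 62 * \<delta>)) \<le> real M * real k + (real q)\<^sup>2 * real P"
      using P by (intro add_left_mono mult_left_mono) auto
    also have "real M * real k + (real q)\<^sup>2 * real P = real (N * q * k + P * q\<^sup>2)"
      by (simp add: M_def)
    also have "\<dots> \<le> real (card E)" using E(3) by (simp only: of_nat_le_iff)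
    also have "2 * real M + real k = real n" using k by simp
    finally show ?thesis .
  qed
  moreover have "real (independence_number {..<n} E) \<le> 2051 * \<delta> * real n"
  proof -
    have "real (independence_number {..<n} E) \<le> real (k + 2 * (\<alpha> * q))" using E(4) by (simp only: of_nat_le_iff)
    also have "\<dots> = real k + 2 * real q * real \<alpha>" by simp
    also have "\<dots> \<le> 125 * \<delta> * real n + 2 * real q * (1926 * \<delta> * real N)"
      using k_le \<alpha> by (intro add_mono mult_left_mono) auto
    also have "\<dots> = 125 * \<delta> * real n + 1926 * \<delta> * (2 * real M)" by (simp add: M_def)
    also have "\<dots> \<le> 125 * \<delta> * real n + 1926 * \<delta> * real n"
      using \<open>2 * M \<le> n\<close> \<delta> by (intro add_left_mono mult_left_mono) auto
    finally show ?thesis by (simp add: algebra_simps)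
  qed
  ultimately show thesis using that E(1,2) by blast
qed

text \<open>For the finitely many small \<open>n\<close>: a one-point \<open>C\<close> with no inner
  edges gives the balanced complete bipartite graph, the extra class holding the odd vertex.\<close>

lemma bipartite_graph:
  assumes "2 \<le> n"
  obtains E where "simple_graph {..<n} E" "complete_free 4 {..<n} E" "real n ^ 2 / 8 \<le> real (card E)"
    "independence_number {..<n} E \<le> n"
proof -
  define q where "q = n div 2"
  define k where "k = n mod 2"
  have n: "n = 2 * (1 * q) + k" by (simp add: q_def k_def)
  have P: "{(c, d). c = () \<and> d = ()} = {((), ())}" by auto
  obtain E where E: "simple_graph {..<n} E" "complete_free 4 {..<n} E" "q * k + q\<^sup>2 \<le> card E"
      "independence_number {..<n} E \<le> k + 2 * q"
    by (rule blowup_graph[of "{()}" "\<lambda>_ _. False" "\<lambda>_ _. True" 1 q k])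
      (use n card_mono[of "{()}"] in \<open>auto simp: P\<close>)
  have "real n ^ 2 / 8 \<le> real (card E)"
  proof -
    have "q \<ge> 1" using assms by (simp add: q_def)
    then have "n\<^sup>2 \<le> 8 * (q * k + q\<^sup>2)"
      using n by (cases "k = 0") (auto simp: power2_eq_square algebra_simps k_def)
    then have "n\<^sup>2 \<le> 8 * card E" using mult_le_mono2[OF E(3), of 8] by (rule order_trans)
    then have "real (n\<^sup>2) \<le> real (8 * card E)" by (simp only: of_nat_le_iff)
    then show ?thesis by simp
  qed
  then show thesis using that E n by simp
qed

lemma floor_scale_bounds:
  fixes L l :: real
  assumes l: "l = ln L" "1 \<le> l" and L: "16 * l \<le> L"
  defines "h \<equiv> nat \<lfloor>L / (4 * l)\<rfloor>"
  shows "4 \<le> h" "L / (8 * l) \<le> real h" "real h * (4 * l) \<le> L"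
proof -
  have a: "4 \<le> L / (4 * l)" using l L by (simp add: field_simps)
  then show "4 \<le> h" by (simp add: h_def le_nat_floor)
  have "L / (4 * l) - 1 \<le> real h" using a unfolding h_def by linarith
  moreover have "L / (8 * l) = L / (4 * l) / 2" by simp
  ultimately show "L / (8 * l) \<le> real h" using a by linarith
  have "real h \<le> L / (4 * l)" unfolding h_def using a by (intro of_nat_floor) auto
  then show "real h * (4 * l) \<le> L" using l by (simp add: pos_le_divide_eq)
qed

text \<open>The case \<open>n = 3\<close> needs \<open>e < 3\<close>, obtained from
  \<open>exp (1/4) \<le> 21/16\<close> by taking fourth powers.\<close>

lemma ln_ln_pos:
  assumes "3 \<le> n"
  shows "0 < ln (ln (real n))"
proof -
  have "exp (1 / 4) \<le> (1::real) + 1 / 4 + (1 / 4)\<^sup>2" by (rule exp_bound) (auto simp: field_simps)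
  then have "exp (1 / 4) ^ 4 \<le> (21 / 16 :: real) ^ 4"
    by (intro power_mono) (auto simp: power2_eq_square)
  moreover have "exp (1 / 4) ^ 4 = exp (1::real)" by (simp flip: exp_of_nat_mult)
  ultimately have "exp 1 < (3::real)" by (simp add: eval_nat_numeral)
  also have "3 \<le> real n" using assms by simp
  finally have "exp 1 < real n" .
  then have "1 < ln (real n)" by (rule exp_less_cancel_iff[THEN iffD1, OF order_less_le_trans]) (use assms in auto)
  then show ?thesis by simp
qed

text \<open>With \<open>h\<close> about \<open>L / (4 l)\<close> one has
  \<open>(4h)^h \<le> exp (h l) \<le> n^(1/4)\<close>, so the blow-up fits into \<open>n\<close>
  vertices, and \<open>\<delta>\<close> is at most three times the target ratio. Hence
  \<open>1488 = 3 * 496\<close> and \<open>6153 = 3 * 2051\<close>.\<close>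

lemma large_graph:
  fixes n :: nat
  defines "L \<equiv> ln (real n)"
  defines "l \<equiv> ln L"
  assumes n: "0 < n" and l: "1 \<le> l" and L: "16 * l \<le> L" "2 * L \<le> exp (L / 4)"
    and small: "1488 * (l powr (3/2) / L powr (1/2)) \<le> 1"
  obtains E where "simple_graph {..<n} E" "complete_free 4 {..<n} E" "real n ^ 2 / 8 \<le> real (card E)"
    "real (independence_number {..<n} E) \<le> 6153 * real n * (l powr (3/2) / L powr (1/2))"
proof -
  define g where "g = l powr (3/2) / L powr (1/2)"
  define h where "h = nat \<lfloor>L / (4 * l)\<rfloor>"
  note h = floor_scale_bounds[OF l_def[THEN meta_eq_to_obj_eq] l L(1), folded h_def]
  define \<delta> where "\<delta> = ln (real h) / sqrt (real h)"
  have L0: "0 < L" using l L by linarith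
  have h4: "4 \<le> real h" using h(1) by simp
  have lnh: "1 \<le> ln (real h)"
  proof -
    have "exp 1 \<le> real h" using exp_le h4 by linarith
    then show ?thesis using h4 by (simp add: ln_ge_iff)
  qed
  have "4 * real h \<le> real h * (4 * l)" using mult_left_mono[OF l, of "4 * real h"] by (simp add: mult_ac)
  then have h4L: "4 * real h \<le> L" using h(3) by linarith
  then have hL: "real h \<le> L" by simp
  have ln4h: "ln (4 * real h) \<le> l" unfolding l_def using h4 h4L by (intro ln_mono) auto
  have lnhl: "ln (real h) \<le> l" unfolding l_def using h4 hL by (intro ln_mono) auto
  have \<delta>g: "\<delta> \<le> 3 * g"
  proof -
    have "\<delta> \<le> l / sqrt (real h)"
      unfolding \<delta>_def using lnhl by (intro divide_right_mono) auto
    also have "\<dots> \<le> l / sqrt (L / (8 * l))"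
      using h(2) l L0 h4 by (intro divide_left_mono) auto
    also have "\<dots> = sqrt 8 * (l * sqrt l) / sqrt L"
      by (simp add: real_sqrt_divide real_sqrt_mult)
    also have "l * sqrt l = l powr (3/2)"
      using l powr_add[of l 1 "1/2"] by (simp add: powr_half_sqrt)
    also have "sqrt L = L powr (1/2)" using L0 by (simp add: powr_half_sqrt)
    also have "sqrt 8 * l powr (3/2) / L powr (1/2) \<le> 3 * l powr (3/2) / L powr (1/2)"
      by (intro divide_right_mono mult_right_mono real_le_lsqrt) auto
    finally show ?thesis by (simp add: g_def)
  qed
  have big: "2 * real (4 * h) ^ h \<le> \<delta> * real n"
  proof -
    have "real (4 * h) ^ h = exp (real h * ln (4 * real h))"
      using h4 by (simp add: exp_of_nat_mult)
    also have "real h * ln (4 * real h) \<le> real h * l" using ln4h by (intro mult_left_mono) auto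
    also have "real h * l \<le> L / 4" using h(3) by simp
    finally have "real (4 * h) ^ h \<le> exp (L / 4)" by simp
    then have "2 * real (4 * h) ^ h * real h \<le> 2 * exp (L / 4) * L"
      using hL by (intro mult_mono) auto
    also have "\<dots> = (2 * L) * exp (L / 4)" by simp
    also have "\<dots> \<le> exp (L / 4) * exp (L / 4)" using L(2) by (intro mult_right_mono) auto
    also have "\<dots> \<le> exp L" using L0 by (simp flip: exp_add)
    also have "\<dots> = real n" using n by (simp add: L_def)
    finally have "2 * real (4 * h) ^ h \<le> real n / real h"
      using h4 by (simp only: pos_le_divide_eq)
    also have "\<dots> = 1 / real h * real n" by simp
    also have "\<dots> \<le> \<delta> * real n"
    proof (rule mult_right_mono)
      have "sqrt (real h) \<le> real h" using h4 by (auto intro!: real_le_lsqrt self_le_power)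
      then have "1 / real h \<le> 1 / sqrt (real h)" using h4 by (intro divide_left_mono) auto
      also have "\<dots> \<le> \<delta>" unfolding \<delta>_def using lnh by (intro divide_right_mono) auto
      finally show "1 / real h \<le> \<delta>" .
    qed simp
    finally show ?thesis .
  qed
  have "496 * \<delta> \<le> 1" using small \<delta>g by (simp add: g_def)
  then obtain E where E: "simple_graph {..<n} E" "complete_free 4 {..<n} E" "real n ^ 2 / 8 \<le> real (card E)"
      "real (independence_number {..<n} E) \<le> 2051 * \<delta> * real n"
    using graph_at_scale[of h n, folded \<delta>_def] lnh big by blast
  have "2051 * \<delta> * real n \<le> 2051 * (3 * g) * real n"
    using \<delta>g by (intro mult_right_mono mult_left_mono) auto
  then have "real (independence_number {..<n} E) \<le> 6153 * real n * g"
    using E(4) by (simp add: mult_ac)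
  then show thesis using that E(1-3) by (simp add: g_def)
qed

theorem theorem1p9:
  shows "\<exists>c'::real. c' > 0 \<and>
    (\<forall>n::nat. n \<ge> 3 \<longrightarrow>
      (\<exists>(V::nat set) E. simple_graph V E \<and> card V = n \<and> complete_free 4 V E \<and>
        real (card E) \<ge> real n ^ 2 / 8 \<and>
        real (independence_number V E)
          \<le> c' * real n * (ln (ln (real n)) powr (3/2) / ln (real n) powr (1/2))))"
proof -
  define g where "g n = ln (ln (real n)) powr (3/2) / ln (real n) powr (1/2)" for n
  have g_pos: "0 < g n" if "3 \<le> n" for n
    using ln_ln_pos[OF that] that by (simp add: g_def)
  have "eventually (\<lambda>x::real. 1 \<le> ln (ln x)) at_top"
    "eventually (\<lambda>x::real. 16 * ln (ln x) \<le> ln x) at_top"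
    "eventually (\<lambda>x::real. 2 * ln x \<le> exp (ln x / 4)) at_top"
    "eventually (\<lambda>x::real. 1488 * (ln (ln x) powr (3/2) / ln x powr (1/2)) \<le> 1) at_top"
    by real_asymp+
  then have "eventually (\<lambda>x::real. 1 \<le> ln (ln x) \<and> 16 * ln (ln x) \<le> ln x
      \<and> 2 * ln x \<le> exp (ln x / 4) \<and> 1488 * (ln (ln x) powr (3/2) / ln x powr (1/2)) \<le> 1) at_top"
    by eventually_elim simp
  then have "eventually (\<lambda>n. 1 \<le> ln (ln (real n)) \<and> 16 * ln (ln (real n)) \<le> ln (real n)
      \<and> 2 * ln (real n) \<le> exp (ln (real n) / 4) \<and> 1488 * g n \<le> 1) sequentially"
    unfolding g_def by (rule eventually_compose_filterlim[OF _ filterlim_real_sequentially])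
  then obtain n0 where n0: "\<And>n. n0 \<le> n \<Longrightarrow> 1 \<le> ln (ln (real n)) \<and> 16 * ln (ln (real n)) \<le> ln (real n)
      \<and> 2 * ln (real n) \<le> exp (ln (real n) / 4) \<and> 1488 * g n \<le> 1"
    by (auto simp: eventually_sequentially)
  \<comment> \<open>The sum covers the finitely many \<open>n\<close> below \<open>n0\<close>: it
    forces \<open>c * g n \<ge> 1\<close> there, so the trivial bound \<open>n\<close> on the
    independence number is enough.\<close>
  define c where "c = 6153 + (\<Sum>n=3..<n0. 1 / g n)"
  have sum0: "0 \<le> (\<Sum>n=3..<n0. 1 / g n)"
    by (intro sum_nonneg divide_nonneg_nonneg less_imp_le[OF g_pos]) auto
  have "\<exists>E. simple_graph {..<n} E \<and> complete_free 4 {..<n} E \<and> real n ^ 2 / 8 \<le> real (card E)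
      \<and> real (independence_number {..<n} E) \<le> c * real n * g n" if n: "3 \<le> n" for n
  proof (cases "n0 \<le> n")
    case True
    obtain E where E: "simple_graph {..<n} E" "complete_free 4 {..<n} E" "real n ^ 2 / 8 \<le> real (card E)"
        "real (independence_number {..<n} E) \<le> 6153 * real n * g n"
      using large_graph[of n] n0[OF True] n unfolding g_def by auto
    have "6153 * real n * g n \<le> c * real n * g n"
      using sum0 g_pos[OF n] by (intro mult_right_mono) (auto simp: c_def)
    then show ?thesis using E by force
  next
    case False
    obtain E where E: "simple_graph {..<n} E" "complete_free 4 {..<n} E" "real n ^ 2 / 8 \<le> real (card E)"
        "independence_number {..<n} E \<le> n"
      using bipartite_graph[of n] n by auto
    have "1 / g n \<le> (\<Sum>n=3..<n0. 1 / g n)"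
      by (rule member_le_sum) (use False n g_pos in \<open>auto simp: less_imp_le\<close>)
    then have "1 / g n \<le> c" by (simp add: c_def)
    then have "1 \<le> c * g n" using g_pos[OF n] by (simp add: pos_divide_le_eq)
    then have "real n * 1 \<le> real n * (c * g n)" by (intro mult_left_mono) auto
    then have "real (independence_number {..<n} E) \<le> c * real n * g n"
      using E(4) by (simp add: mult_ac)
    then show ?thesis using E by blast
  qed
  moreover have "0 < c" using sum0 by (simp add: c_def)
  ultimately show ?thesis
    unfolding g_def by (intro exI[of _ c]) (metis card_lessThan)
qed

end
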